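(* Let $(X,Y,Z)$ be a random variable taking values in a product of measurable spaces such that $X$ and $Z$ are independent conditionally on $Y$ and the conditional probability distribution $P_{Z|Y}$ exists. Then for any $f\in\mathbb F$, $$S_f(X,Z)\le S_f(X,Y).$$
   Context: A proper convex function on $\mathbb R$ is a convex function with values in $(-\infty,+\infty]$ finite at some point; $\mathrm{dom}(f)=f^{-1}(\mathbb R)$. $\mathbb F$ is the set of proper convex functions $f$ on $\mathbb R$ with $\mathrm{dom}(f)\subset[0,\infty)$, right continuous at $0$ (i.e. $f(0)=\lim_{t\to0+}f(t)\in(-\infty,+\infty]$), $f(1)=0$, and $1$ in the interior of $\mathrm{dom}(f)$. For $f\in\mathbb F$, $f^*(0):=\lim_{t\to+\infty}f(t)/t$. For probability measures $P,Q$ on the same measurable space, with densities $p,q$ w.r.t. a dominating $\sigma$-finite measure, $\frac{dP}{dQ}:=p/q\in[0,+\infty]$ (convention $0/0=0$), defined $(P+Q)$-a.e., and $$D_f(P\Vert Q)=\int f\left(\frac{dP}{dQ}\right)dQ+f^*(0)\,P\left(\frac{dP}{dQ}=+\infty\right),$$ the last term being $0$ by convention if $P\ll Q$. The Csiszár index is $S_f(X,Y)=D_f(P_X\otimes P_Y\,\Vert\,P_{(X,Y)})$, with $P_Z$ the distribution of $Z$; it may be infinite. $P_{Z|Y}$ denotes the (regular) conditional distribution of $Z$ given $Y$: a Markov kernel with $P_{(Y,Z)}(dy,dz)=P_Y(dy)P_{Z|Y=y}(dz)$. *)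

theory Defs
  imports "HOL-Probability.Probability"
begin

section \<open>Proper convex functions\<close>

text \<open>
  Functions on the real line with values in the extended reals; since \<open>-\<infinity>\<close> is
  excluded, no undefined sum can occur in the convexity inequality.
\<close>

definition eff_dom :: "(real \<Rightarrow> ereal) \<Rightarrow> real set" where
  "eff_dom f = {t. \<bar>f t\<bar> \<noteq> \<infinity>}"

definition proper_convex :: "(real \<Rightarrow> ereal) \<Rightarrow> bool" where
  "proper_convex f \<longleftrightarrow>
     (\<forall>t. f t \<noteq> -\<infinity>) \<and> eff_dom f \<noteq> {} \<and>
     (\<forall>s t u. 0 < u \<and> u < 1 \<longrightarrow>
        f ((1 - u) * s + u * t) \<le> ereal (1 - u) * f s + ereal u * f t)"

definition csiszar_functions :: "(real \<Rightarrow> ereal) set" where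
  "csiszar_functions =
     {f. proper_convex f \<and> eff_dom f \<subseteq> {0..} \<and> (f \<longlongrightarrow> f 0) (at_right 0) \<and>
         f 1 = 0 \<and> 1 \<in> interior (eff_dom f)}"

text \<open>The limit exists in \<open>(-\<infinity>, \<infinity>]\<close> for every proper convex function.\<close>

definition adjoint_at_0 :: "(real \<Rightarrow> ereal) \<Rightarrow> ereal" where
  "adjoint_at_0 f = Lim at_top (\<lambda>t. f t / ereal t)"


section \<open>Divergences\<close>

text \<open>
  Integral of an extended real-valued function, as the integral of the positive part minus
  that of the negative part (the coercion \<^const>\<open>e2ennreal\<close> sends negative values to 0). In
  the divergence below the negative part always has a finite integral, because a
  proper convex function has an affine minorant.
\<close>

definition ereal_integral :: "'a measure \<Rightarrow> ('a \<Rightarrow> ereal) \<Rightarrow> ereal" where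
  "ereal_integral M g =
     enn2ereal (\<integral>\<^sup>+ x. e2ennreal (g x) \<partial>M) - enn2ereal (\<integral>\<^sup>+ x. e2ennreal (- g x) \<partial>M)"

definition add_measures :: "'a measure \<Rightarrow> 'a measure \<Rightarrow> 'a measure" where
  "add_measures P Q = measure_of (space P) (sets P) (\<lambda>A. emeasure P A + emeasure Q A)"

text \<open>
  The ratio \<open>dP/dQ\<close> of the densities of \<open>P\<close> and \<open>Q\<close> with respect to \<open>P + Q\<close>. Division on
  \<^typ>\<open>ennreal\<close> satisfies \<open>0 / 0 = 0\<close> and \<open>a / 0 = \<infinity>\<close> for \<open>a > 0\<close>. Lemma
  \<open>f_divergence_eq\<close> below shows that any other dominating \<open>\<sigma>\<close>-finite measure, with any choice
  of the densities, leads to the same divergence.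
\<close>

definition likelihood_ratio :: "'a measure \<Rightarrow> 'a measure \<Rightarrow> 'a \<Rightarrow> ennreal" where
  "likelihood_ratio P Q x = RN_deriv (add_measures P Q) P x / RN_deriv (add_measures P Q) Q x"

text \<open>
  The ratio is finite \<open>Q\<close>-almost everywhere, so its conversion to a real number in the first
  term is harmless. The product in the second term vanishes if
  \<open>P\<close> is absolutely continuous with respect to \<open>Q\<close>, even if \<open>adjoint_at_0 f = \<infinity>\<close>,
  because \<open>\<infinity> * 0 = 0\<close> on \<^typ>\<open>ereal\<close>.
\<close>

definition f_divergence_ratio ::
    "(real \<Rightarrow> ereal) \<Rightarrow> ('a \<Rightarrow> ennreal) \<Rightarrow> 'a measure \<Rightarrow> 'a measure \<Rightarrow> ereal" where
  "f_divergence_ratio f r P Q =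
     ereal_integral Q (\<lambda>x. f (enn2real (r x))) +
     adjoint_at_0 f * ereal (measure P {x \<in> space P. r x = \<infinity>})"

definition f_divergence :: "(real \<Rightarrow> ereal) \<Rightarrow> 'a measure \<Rightarrow> 'a measure \<Rightarrow> ereal" where
  "f_divergence f P Q = f_divergence_ratio f (likelihood_ratio P Q) P Q"

lemma sets_add_measures [simp, measurable_cong]: "sets (add_measures P Q) = sets P"
  and space_add_measures [simp]: "space (add_measures P Q) = space P"
  by (simp_all add: add_measures_def)

lemma emeasure_add_measures:
  assumes "sets P = sets Q" "A \<in> sets P"
  shows "emeasure (add_measures P Q) A = emeasure P A + emeasure Q A"
  unfolding add_measures_def
proof (rule emeasure_measure_of_sigma)
  show "sigma_algebra (space P) (sets P)"
    by (rule sets.sigma_algebra_axioms)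
  show "positive (sets P) (\<lambda>A. emeasure P A + emeasure Q A)"
    by (simp add: positive_def)
  show "countably_additive (sets P) (\<lambda>A. emeasure P A + emeasure Q A)"
    unfolding countably_additive_def
  proof (intro allI impI)
    fix B :: "nat \<Rightarrow> 'a set"
    assume B: "range B \<subseteq> sets P" "disjoint_family B"
    have "(\<Sum>i. emeasure P (B i) + emeasure Q (B i)) =
        (\<Sum>i. emeasure P (B i)) + (\<Sum>i. emeasure Q (B i))"
      by (rule suminf_add[symmetric]) auto
    also have "\<dots> = emeasure P (\<Union>i. B i) + emeasure Q (\<Union>i. B i)"
      using B assms(1) by (simp add: suminf_emeasure)
    finally show "(\<Sum>i. emeasure P (B i) + emeasure Q (B i)) =
        emeasure P (\<Union>i. B i) + emeasure Q (\<Union>i. B i)" .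
  qed
qed (fact assms(2))

lemma f_divergence_eq:
  assumes "finite_measure P" "finite_measure Q" "sigma_finite_measure \<mu>"
    and [measurable]: "p \<in> borel_measurable \<mu>" "q \<in> borel_measurable \<mu>"
    and P: "density \<mu> p = P" and Q: "density \<mu> q = Q"
  shows "f_divergence f P Q = f_divergence_ratio f (\<lambda>x. p x / q x) P Q"
proof -
  interpret P: finite_measure P by fact
  interpret Q: finite_measure Q by fact
  interpret \<mu>: sigma_finite_measure \<mu> by fact
  define \<nu> where "\<nu> = add_measures P Q"
  have sP [measurable_cong, simp]: "sets P = sets \<mu>" and sQ [measurable_cong, simp]: "sets Q = sets \<mu>"
    using P Q by auto
  have spP [simp]: "space P = space \<mu>"
    using P by auto
  have s\<nu> [measurable_cong, simp]: "sets \<nu> = sets \<mu>" and sp\<nu> [simp]: "space \<nu> = space \<mu>"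
    by (simp_all add: \<nu>_def)
  have em: "emeasure \<nu> A = emeasure P A + emeasure Q A" if "A \<in> sets \<mu>" for A
    unfolding \<nu>_def by (rule emeasure_add_measures) (use that in auto)
  have \<nu>: "\<nu> = density \<mu> (\<lambda>x. p x + q x)"
  proof (rule measure_eqI)
    fix A assume "A \<in> sets \<nu>"
    then have A [measurable]: "A \<in> sets \<mu>" by simp
    have "emeasure \<nu> A = emeasure (density \<mu> p) A + emeasure (density \<mu> q) A"
      using em[OF A] P Q by simp
    then show "emeasure \<nu> A = emeasure (density \<mu> (\<lambda>x. p x + q x)) A"
      by (simp add: emeasure_density nn_integral_add distrib_right)
  qed simp
  interpret \<nu>: finite_measure \<nu>
    by (rule finite_measureI) (simp add: em P.emeasure_finite Q.emeasure_finite)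
  have acP: "absolutely_continuous \<nu> P" and acQ: "absolutely_continuous \<nu> Q"
    unfolding absolutely_continuous_def null_sets_def by (auto simp: em)
  have dens: "AE x in \<mu>. d x = (p x + q x) * RN_deriv \<nu> R x"
    if [measurable]: "d \<in> borel_measurable \<mu>" and R: "density \<mu> d = R"
      and ac: "absolutely_continuous \<nu> R" for d R
  proof -
    have [measurable]: "RN_deriv \<nu> R \<in> borel_measurable \<mu>"
      using borel_measurable_RN_deriv[of \<nu> R] by (simp cong: measurable_cong_sets)
    have "density \<nu> (RN_deriv \<nu> R) = R"
      by (rule \<nu>.density_RN_deriv) (use ac R in auto)
    then have "density \<mu> d = density \<mu> (\<lambda>x. (p x + q x) * RN_deriv \<nu> R x)"
      using R by (simp add: \<nu> density_density_eq)
    then show ?thesis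
      by (subst (asm) \<mu>.density_unique_iff) auto
  qed
  have AEP: "AE x in \<mu>. p x = (p x + q x) * RN_deriv \<nu> P x"
    by (rule dens) (use P acP in auto)
  have AEQ: "AE x in \<mu>. q x = (p x + q x) * RN_deriv \<nu> Q x"
    by (rule dens) (use Q acQ in auto)
  have fin: "AE x in \<mu>. d x \<noteq> \<infinity>"
    if [measurable]: "d \<in> borel_measurable \<mu>" and R: "finite_measure (density \<mu> d)" for d
  proof (rule nn_integral_PInf_AE)
    have "emeasure (density \<mu> d) (space \<mu>) \<noteq> \<infinity>"
      using finite_measure.emeasure_finite[OF R] by simp
    then show "integral\<^sup>N \<mu> d \<noteq> \<infinity>"
      by (simp add: emeasure_density cong: nn_integral_cong)
  qed simp
  have finp: "AE x in \<mu>. p x \<noteq> \<infinity>" and finq: "AE x in \<mu>. q x \<noteq> \<infinity>"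
    using fin[of p] fin[of q] P Q P.finite_measure_axioms Q.finite_measure_axioms by auto
  have ratio: "AE x in \<mu>. p x + q x \<noteq> 0 \<longrightarrow> p x / q x = likelihood_ratio P Q x"
    using AEP AEQ finp finq
  proof eventually_elim
    case (elim x)
    define c where "c = p x + q x"
    have c: "c \<noteq> \<infinity>" using elim by (simp add: c_def)
    have eqs: "p x = c * RN_deriv \<nu> P x" "q x = c * RN_deriv \<nu> Q x"
      using elim by (simp_all add: c_def)
    have "p x / q x = RN_deriv \<nu> P x / RN_deriv \<nu> Q x" if "c \<noteq> 0"
    proof -
      have "RN_deriv \<nu> Q x < top"
        using eqs(2) elim that by (auto simp: top.not_eq_extremum[symmetric] ennreal_mult_eq_top_iff)
      then have "inverse (c * RN_deriv \<nu> Q x) = inverse c * inverse (RN_deriv \<nu> Q x)"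
        using c that by (cases "RN_deriv \<nu> Q x = 0") (auto intro!: ennreal_inverse_mult simp: less_top)
      moreover have "c * inverse c = 1"
        using c that ennreal_divide_self[of c] by (simp add: divide_ennreal_def less_top)
      ultimately show ?thesis
        unfolding eqs divide_ennreal_def by (metis mult.assoc mult.commute mult_1)
    qed
    then show ?case
      by (simp add: c_def likelihood_ratio_def \<nu>_def)
  qed
  have ratioP: "AE x in P. p x / q x = likelihood_ratio P Q x"
    unfolding P[symmetric] by (subst AE_density) (use ratio P in \<open>auto elim!: eventually_mono\<close>)
  have ratioQ: "AE x in Q. p x / q x = likelihood_ratio P Q x"
    unfolding Q[symmetric] by (subst AE_density) (use ratio Q in \<open>auto elim!: eventually_mono\<close>)
  have [measurable]: "likelihood_ratio P Q \<in> borel_measurable \<mu>"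
  proof -
    have "RN_deriv \<nu> R \<in> borel_measurable \<mu>" for R
      using borel_measurable_RN_deriv[of \<nu> R] by (simp cong: measurable_cong_sets)
    then show ?thesis
      unfolding likelihood_ratio_def \<nu>_def[symmetric] by measurable
  qed
  have "measure P {x \<in> space P. p x / q x = \<infinity>} =
      measure P {x \<in> space P. likelihood_ratio P Q x = \<infinity>}"
    by (rule measure_eq_AE) (use ratioP in \<open>auto elim!: eventually_mono\<close>)
  moreover have "ereal_integral Q (\<lambda>x. f (enn2real (p x / q x))) =
      ereal_integral Q (\<lambda>x. f (enn2real (likelihood_ratio P Q x)))"
    unfolding ereal_integral_def
    by (intro arg_cong2[where f="(-)"] arg_cong[where f=enn2ereal] nn_integral_cong_AE)
      (use ratioQ in \<open>auto elim!: eventually_mono\<close>)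
  ultimately show ?thesis
    by (simp add: f_divergence_def f_divergence_ratio_def)
qed


section \<open>The Csiszar index\<close>

definition csiszar_index ::
    "(real \<Rightarrow> ereal) \<Rightarrow> 'w measure \<Rightarrow> 'a measure \<Rightarrow> 'b measure \<Rightarrow> ('w \<Rightarrow> 'a) \<Rightarrow> ('w \<Rightarrow> 'b) \<Rightarrow> ereal"
  where
  "csiszar_index f M MX MY X Y =
     f_divergence f (distr M MX X \<Otimes>\<^sub>M distr M MY Y) (distr M (MX \<Otimes>\<^sub>M MY) (\<lambda>\<omega>. (X \<omega>, Y \<omega>)))"


section \<open>Conditioning\<close>

definition cond_indep ::
    "'w measure \<Rightarrow> 'a measure \<Rightarrow> 'b measure \<Rightarrow> 'c measure \<Rightarrow>
     ('w \<Rightarrow> 'a) \<Rightarrow> ('w \<Rightarrow> 'b) \<Rightarrow> ('w \<Rightarrow> 'c) \<Rightarrow> bool"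
  where
  "cond_indep M MX MY MZ X Y Z \<longleftrightarrow>
     (let F = vimage_algebra (space M) Y MY in
      \<forall>A\<in>sets MX. \<forall>C\<in>sets MZ.
        AE \<omega> in M.
          real_cond_exp M F (\<lambda>\<omega>. indicator A (X \<omega>) * indicator C (Z \<omega>)) \<omega> =
          real_cond_exp M F (\<lambda>\<omega>. indicator A (X \<omega>)) \<omega> *
          real_cond_exp M F (\<lambda>\<omega>. indicator C (Z \<omega>)) \<omega>)"

text \<open>The Markov kernel \<open>K\<close> is a regular conditional distribution of \<open>Z\<close> given \<open>Y\<close>.\<close>

definition cond_distribution ::
    "'w measure \<Rightarrow> 'b measure \<Rightarrow> 'c measure \<Rightarrow> ('w \<Rightarrow> 'b) \<Rightarrow> ('w \<Rightarrow> 'c) \<Rightarrow> ('b \<Rightarrow> 'c measure) \<Rightarrow> bool"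
  where
  "cond_distribution M MY MZ Y Z K \<longleftrightarrow>
     K \<in> measurable MY (prob_algebra MZ) \<and>
     (\<forall>E\<in>sets (MY \<Otimes>\<^sub>M MZ).
        emeasure (distr M (MY \<Otimes>\<^sub>M MZ) (\<lambda>\<omega>. (Y \<omega>, Z \<omega>))) E =
        (\<integral>\<^sup>+ y. \<integral>\<^sup>+ z. indicator E (y, z) \<partial>K y \<partial>distr M MY Y))"

end

theory Submission
  imports Defs
begin

text \<open>
  Let \<open>K\<close> be the conditional distribution of \<open>Z\<close> given \<open>Y\<close>. The Markov kernel that keeps \<open>x\<close> and
  replaces \<open>y\<close> by a value drawn from \<open>K y\<close> maps the product of the laws of \<open>X\<close> and \<open>Y\<close> to the product of
  the laws of \<open>X\<close> and \<open>Z\<close>, and, by conditional independence, the joint law of \<open>X\<close> and \<open>Y\<close> to that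
  of \<open>X\<close> and \<open>Z\<close> (\<open>product_law_bind\<close>, \<open>joint_law_bind\<close>). The theorem is thus an instance of the data
  processing inequality for divergences, \<open>f_divergence_bind_le\<close>.

  That inequality is proved from a dual description of the divergence, without disintegrating
  any measure. After subtraction of its tangent at \<open>1\<close>, the function \<open>f\<close> is nonnegative, and the
  divergence is the integral of its perspective \<open>q * f (p / q)\<close>, where \<open>p\<close> and \<open>q\<close> are densities
  for a common dominating measure (\<open>f_divergence_eq_perspective\<close>). Where \<open>q\<close> vanishes the
  perspective is \<open>p\<close> times the slope at infinity, so the singular term is included. If \<open>f\<close>
  is the supremum of affine functions \<open>a * t + b\<close>, then the perspective is the supremum of the
  linear functions \<open>a * p + b * q\<close>. Integrals of linear functions of the densities are
  transported by the kernel without loss, and they only grow on replacing the linear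
  function by the perspective. By passing to the supremum, which can be taken over countably
  many functions, one obtains the inequality.

  A convex function need not be the supremum of its affine minorants at the endpoints of
  its domain, since it may jump there, upwards. There a second argument applies. If a
  divergence is finite and \<open>e\<close> is the right endpoint, then \<open>p \<le> e * q\<close> almost everywhere. Hence a set
  on which the images under the kernel satisfy \<open>p' = e * q'\<close> receives mass only from points where
  already \<open>p = e * q\<close>, and the value \<open>f e\<close> is counted with the same mass on both sides. The left
  endpoint is symmetric. In the formal proof these two cases are the two kinds
  of members of the family \<open>supports\<close>, and \<open>density_persp_bind\<close> treats them together.
\<close>

section \<open>Affine minorants of a convex function\<close>

definition affine_minorants :: "(real \<Rightarrow> ereal) \<Rightarrow> (real \<times> real) set" where
  "affine_minorants f = {(a, b). \<forall>t. ereal (a * t + b) \<le> f t}"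

context
  fixes f :: "real \<Rightarrow> ereal"
  assumes f: "f \<in> csiszar_functions"
begin

lemma eff_dom_nonneg: "eff_dom f \<subseteq> {0..}"
  and one_in_interior: "1 \<in> interior (eff_dom f)"
  and at_one: "f 1 = 0"
  and convexity_inequality: "0 < u \<Longrightarrow> u < 1 \<Longrightarrow>
    f ((1 - u) * s + u * t) \<le> ereal (1 - u) * f s + ereal u * f t"
  and not_MInf: "f t \<noteq> -\<infinity>"
  using f by (auto simp: csiszar_functions_def proper_convex_def)

lemma off_eff_dom: "t \<notin> eff_dom f \<Longrightarrow> f t = \<infinity>"
  using not_MInf[of t] by (auto simp: eff_dom_def)

lemma on_eff_dom: "t \<in> eff_dom f \<Longrightarrow> f t = ereal (real_of_ereal (f t))"
  by (auto simp: eff_dom_def ereal_real)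

lemma convex_on_eff_dom: "convex_on (eff_dom f) (\<lambda>t. real_of_ereal (f t))"
proof -
  have le: "f ((1 - u) * s + u * t) \<le> ereal ((1 - u) * real_of_ereal (f s) + u * real_of_ereal (f t))"
    if "0 < u" "u < 1" "s \<in> eff_dom f" "t \<in> eff_dom f" for s t u
    using convexity_inequality[OF that(1,2), of s t] on_eff_dom[OF that(3)] on_eff_dom[OF that(4)]
    by (metis plus_ereal.simps(1) times_ereal.simps(1))
  have dom: "(1 - u) * s + u * t \<in> eff_dom f"
    if "0 < u" "u < 1" "s \<in> eff_dom f" "t \<in> eff_dom f" for s t u
    using le[OF that] off_eff_dom by force
  have "convex (eff_dom f)"
    unfolding convex_alt
  proof (intro ballI allI impI)
    fix s t u :: real assume "s \<in> eff_dom f" "t \<in> eff_dom f" "0 \<le> u \<and> u \<le> 1"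
    then show "(1 - u) *\<^sub>R s + u *\<^sub>R t \<in> eff_dom f"
      using dom[of u s t] by (cases "u = 0 \<or> u = 1") auto
  qed
  then show ?thesis
  proof (rule convex_onI[rotated])
    fix u s t :: real assume *: "0 < u" "u < 1" "s \<in> eff_dom f" "t \<in> eff_dom f"
    show "real_of_ereal (f ((1 - u) *\<^sub>R s + u *\<^sub>R t))
        \<le> (1 - u) * real_of_ereal (f s) + u * real_of_ereal (f t)"
      using le[OF *] on_eff_dom[OF dom[OF *]] by (metis ereal_less_eq(3) real_scaleR_def)
  qed
qed

lemma convex_eff_dom: "convex (eff_dom f)"
  using convex_on_eff_dom convex_on_imp_convex by blast

lemma one_in_eff_dom: "1 \<in> eff_dom f"
  using one_in_interior interior_subset by blast

lemma off_nonneg: "t < 0 \<Longrightarrow> f t = \<infinity>"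
  using eff_dom_nonneg off_eff_dom by force

text \<open>
Only in the interior of the domain does a convex function have to have a tangent; at an
endpoint of the domain \<open>f\<close> may be discontinuous, or have a vertical tangent.
\<close>

lemma ex_tangent:
  assumes s: "s \<in> interior (eff_dom f)"
  shows "\<exists>(a, b)\<in>affine_minorants f. ereal (a * s + b) = f s"
proof -
  define F where "F t = real_of_ereal (f t)" for t
  obtain a where a: "\<And>t. t \<in> eff_dom f \<Longrightarrow> F s + a * (t - s) \<le> F t"
    using convex_le_Inf_differential[OF convex_on_eff_dom s] unfolding F_def by blast
  have "ereal (a * t + (F s - a * s)) \<le> f t" for t
  proof (cases "t \<in> eff_dom f")
    case True
    then have "f t = ereal (F t)"
      unfolding F_def by (rule on_eff_dom)
    then show ?thesis
      using a[OF True] by (simp add: algebra_simps)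
  qed (simp add: off_eff_dom)
  moreover have "ereal (a * s + (F s - a * s)) = f s"
    using on_eff_dom[of s] s interior_subset[of "eff_dom f"] by (auto simp: F_def)
  ultimately show ?thesis
    by (intro bexI[of _ "(a, F s - a * s)"]) (auto simp: affine_minorants_def)
qed

text \<open>
Beyond an endpoint of the domain the minorants are unbounded: adding to one of them a
multiple of a line that vanishes at the endpoint and is at most \<open>0\<close> on the domain gives another
one. On the right this also produces minorants of arbitrarily large slope, in accordance with
\<open>adjoint_at_0 f = \<infinity>\<close>.
\<close>

lemma ex_steep_up:
  assumes "eff_dom f \<subseteq> {..u}"
  shows "\<exists>(a, b)\<in>affine_minorants f. c < a \<and> (u < t \<longrightarrow> c < a * t + b)"
proof -
  obtain a b where ab: "(a, b) \<in> affine_minorants f"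
    using ex_tangent[OF one_in_interior] by auto
  \<comment> \<open>The multiple that lifts both the slope and the value at \<open>t\<close> above \<open>c\<close>.\<close>
  obtain n where n: "n \<ge> 0" "c < a + n" "u < t \<longrightarrow> c - (a * t + b) < n * (t - u)"
  proof (cases "u < t")
    case True
    define n where "n = max 0 (max (c - a) ((c - (a * t + b)) / (t - u))) + 1"
    have "(c - (a * t + b)) / (t - u) < n" by (simp add: n_def)
    then show ?thesis using True
      by (intro that[of n]) (auto simp: n_def field_simps)
  next
    case False
    then show ?thesis by (intro that[of "max 0 (c - a) + 1"]) auto
  qed
  have "ereal ((a + n) * s + (b - n * u)) \<le> f s" for s
  proof (cases "s \<in> eff_dom f")
    case True
    then have "n * s \<le> n * u" using assms n(1) by (auto intro!: mult_left_mono)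
    then have "(a + n) * s + (b - n * u) \<le> a * s + b" by (simp add: algebra_simps)
    then show ?thesis using ab unfolding affine_minorants_def
      by (auto intro: order_trans[of _ "ereal (a * s + b)"])
  qed (simp add: off_eff_dom)
  then have "(a + n, b - n * u) \<in> affine_minorants f"
    by (simp add: affine_minorants_def)
  then show ?thesis
    using n by (intro bexI[of _ "(a + n, b - n * u)"]) (auto simp: algebra_simps)
qed

lemma ex_steep_down:
  assumes "eff_dom f \<subseteq> {l..}" "t < l"
  shows "\<exists>(a, b)\<in>affine_minorants f. c < a * t + b"
proof -
  obtain a b where ab: "(a, b) \<in> affine_minorants f"
    using ex_tangent[OF one_in_interior] by auto
  define n where "n = max 0 ((c - (a * t + b)) / (l - t)) + 1"
  have "(c - (a * t + b)) / (l - t) < n" by (simp add: n_def)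
  then have n: "n \<ge> 0" "c - (a * t + b) < n * (l - t)"
    using assms(2) by (auto simp: n_def field_simps)
  have "ereal ((a - n) * s + (b + n * l)) \<le> f s" for s
  proof (cases "s \<in> eff_dom f")
    case True
    then have "n * l \<le> n * s" using assms n(1) by (auto intro!: mult_left_mono)
    then have "(a - n) * s + (b + n * l) \<le> a * s + b" by (simp add: algebra_simps)
    then show ?thesis using ab unfolding affine_minorants_def
      by (auto intro: order_trans[of _ "ereal (a * s + b)"])
  qed (simp add: off_eff_dom)
  then have "(a - n, b + n * l) \<in> affine_minorants f"
    by (simp add: affine_minorants_def)
  then show ?thesis
    using n by (intro bexI[of _ "(a - n, b + n * l)"]) (auto simp: algebra_simps)
qed

lemma ex_minorant_off_closure:
  assumes t: "t \<notin> closure (eff_dom f)"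
  shows "\<exists>(a, b)\<in>affine_minorants f. c < a * t + b"
proof -
  obtain e where e: "e > 0" "ball t e \<subseteq> - closure (eff_dom f)"
    using t openE[of "- closure (eff_dom f)" t] by blast
  have far: "e \<le> \<bar>s - t\<bar>" if "s \<in> eff_dom f" for s
    using that e closure_subset[of "eff_dom f"] by (force simp: dist_real_def subset_iff abs_minus_commute)
  have between: "\<not> (r \<le> t \<and> t \<le> s)" if "r \<in> eff_dom f" "s \<in> eff_dom f" for r s
    using that t convex_eff_dom closure_subset[of "eff_dom f"] is_interval_convex_1[of "eff_dom f"]
      mem_is_interval_1_I by blast
  show ?thesis
  proof (cases "1 \<le> t")
    case True
    have "eff_dom f \<subseteq> {..t - e}"
    proof
      fix s assume s: "s \<in> eff_dom f"
      show "s \<in> {..t - e}"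
        using between[OF one_in_eff_dom s] far[OF s] True by (auto simp: abs_if split: if_splits)
    qed
    from ex_steep_up[OF this, of c t] e show ?thesis by force
  next
    case False
    have "eff_dom f \<subseteq> {t + e..}"
    proof
      fix s assume s: "s \<in> eff_dom f"
      show "s \<in> {t + e..}"
        using between[OF s one_in_eff_dom] far[OF s] False by (auto simp: abs_if split: if_splits)
    qed
    from ex_steep_down[OF this, of t c] e show ?thesis by force
  qed
qed

text \<open>
Countably many minorants have to suffice, in order to exchange their supremum with an
integral. Lowering both coefficients slightly lowers the line everywhere on \<open>{0..}\<close>, and to
the left of \<open>0\<close> a minorant is not constrained, since \<open>f\<close> is infinite there.
\<close>

lemma ex_rational_minorant:
  assumes "(a, b) \<in> affine_minorants f" "t \<ge> 0" "c < a * t + b" "d < a"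
  shows "\<exists>(a', b')\<in>affine_minorants f \<inter> \<rat> \<times> \<rat>. c < a' * t + b' \<and> d < a'"
proof -
  \<comment> \<open>Lowering both coefficients by \<open>\<delta>\<close> brings the value at \<open>t\<close> down to exactly \<open>c\<close>.\<close>
  define \<delta> where "\<delta> = (a * t + b - c) / (t + 1)"
  have \<delta>: "\<delta> > 0" "\<delta> * (t + 1) = a * t + b - c"
    using assms by (auto simp: \<delta>_def)
  obtain a' where a': "a' \<in> \<rat>" "max d (a - \<delta>) < a'" "a' < a"
    using Rats_dense_in_real[of "max d (a - \<delta>)" a] \<delta>(1) assms(4) by auto
  obtain b' where b': "b' \<in> \<rat>" "b - \<delta> < b'" "b' < b"
    using Rats_dense_in_real[of "b - \<delta>" b] \<delta>(1) by auto
  have "ereal (a' * s + b') \<le> f s" for s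
  proof (cases "s < 0")
    case False
    then have "a' * s \<le> a * s" using a' by (auto intro!: mult_right_mono)
    then have "ereal (a' * s + b') \<le> ereal (a * s + b)" using b' by simp
    also have "\<dots> \<le> f s" using assms(1) by (auto simp: affine_minorants_def)
    finally show ?thesis .
  qed (simp add: off_nonneg)
  moreover have "c < a' * t + b'"
  proof -
    have "(a - \<delta>) * t \<le> a' * t" using a' assms(2) by (auto intro!: mult_right_mono)
    then show ?thesis using b' \<delta>(2) by (simp add: algebra_simps)
  qed
  ultimately show ?thesis
    using a' b' by (intro bexI[of _ "(a', b')"]) (auto simp: affine_minorants_def)
qed

lemma ex_rational_minorant_above:
  assumes "t \<ge> 0" "t \<notin> frontier (eff_dom f)" "ereal c < f t"
  shows "\<exists>(a, b)\<in>affine_minorants f \<inter> \<rat> \<times> \<rat>. c < a * t + b"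
proof -
  obtain a b where "(a, b) \<in> affine_minorants f" "c < a * t + b"
  proof (cases "t \<in> interior (eff_dom f)")
    case True
    from ex_tangent[OF this] obtain a b where "(a, b) \<in> affine_minorants f" "ereal (a * t + b) = f t"
      by auto
    then show ?thesis using assms(3) by (intro that[of a b]) (auto simp flip: \<open>_ = f t\<close>)
  next
    case False
    then have "t \<notin> closure (eff_dom f)" using assms(2) by (simp add: frontier_def)
    from ex_minorant_off_closure[OF this, of c] that show ?thesis by auto
  qed
  from ex_rational_minorant[OF this(1) assms(1) this(2), of "a - 1"] show ?thesis by auto
qed

text \<open>
A minorant of slope \<open>a\<close> bounds \<open>f t / t\<close> from below by \<open>a\<close> in the limit. Conversely, if the slopes
are bounded, then the domain is unbounded on the right, so that \<open>f\<close> has a tangent at every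
\<open>t > 1\<close>; it is at most \<open>0\<close> at \<open>1\<close>, whence \<open>f t\<close> is at most its slope times \<open>t - 1\<close>.
\<close>

lemma adjoint_eq_Sup_slopes:
  "adjoint_at_0 f = (SUP (a, b)\<in>affine_minorants f. ereal a)"
proof -
  define S where "S = (SUP (a, b)\<in>affine_minorants f. ereal a)"
  have upper: "ereal a \<le> S" if "(a, b) \<in> affine_minorants f" for a b
    unfolding S_def using that by (auto intro!: SUP_upper2[of "(a, b)"])
  have lower: "\<forall>\<^sub>F t in at_top. c < f t / ereal t" if c: "c < S" for c
  proof -
    obtain a b where ab: "(a, b) \<in> affine_minorants f" "c < ereal a"
      using c unfolding S_def less_SUP_iff by auto
    have "((\<lambda>t. ereal (a + b / t)) \<longlongrightarrow> ereal a) at_top"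
      by (intro tendsto_ereal tendsto_add[of _ a _ _ 0, simplified] tendsto_const
          tendsto_divide_0[OF tendsto_const] filterlim_at_top_imp_at_infinity filterlim_ident)
    then have "\<forall>\<^sub>F t in at_top. c < ereal (a + b / t)"
      using ab(2) by (rule order_tendstoD)
    with eventually_gt_at_top[of 0] show ?thesis
    proof eventually_elim
      case (elim t)
      have "ereal (a + b / t) = ereal (a * t + b) / ereal t"
        using elim(1) by (simp add: field_simps)
      also have "\<dots> \<le> f t / ereal t"
        using ab(1) elim(1) by (intro ereal_divide_right_mono) (auto simp: affine_minorants_def)
      finally show ?case using elim(2) by simp
    qed
  qed
  have "((\<lambda>t. f t / ereal t) \<longlongrightarrow> S) at_top"
  proof (rule order_tendstoI[OF lower])
    fix c assume c: "S < c"
    obtain a b where "(a, b) \<in> affine_minorants f"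
      using ex_tangent[OF one_in_interior] by auto
    from upper[OF this] c obtain \<sigma> where \<sigma>: "S = ereal \<sigma>"
      by (cases S) auto
    have interior: "t \<in> interior (eff_dom f)" if t: "1 < t" for t
    proof (rule ccontr)
      assume *: "t \<notin> interior (eff_dom f)"
      have "eff_dom f \<subseteq> {..t}"
      proof (rule ccontr)
        assume "\<not> eff_dom f \<subseteq> {..t}"
        then obtain s where s: "s \<in> eff_dom f" "t < s" by force
        then have "open_segment 1 s \<subseteq> interior (eff_dom f)"
          by (intro in_interior_closure_convex_segment convex_eff_dom one_in_interior)
             (use closure_subset in auto)
        then show False using * t s by (auto simp: open_segment_eq_real_ivl)
      qed
      from ex_steep_up[OF this, of \<sigma>] upper \<sigma> show False by force
    qed
    have "((\<lambda>t. ereal (\<sigma> - \<sigma> / t)) \<longlongrightarrow> ereal \<sigma>) at_top"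
      by (intro tendsto_ereal tendsto_diff[of _ \<sigma> _ _ 0, simplified] tendsto_const
          tendsto_divide_0[OF tendsto_const] filterlim_at_top_imp_at_infinity filterlim_ident)
    then have "\<forall>\<^sub>F t in at_top. ereal (\<sigma> - \<sigma> / t) < c"
      by (rule order_tendstoD) (use c \<sigma> in auto)
    with eventually_gt_at_top[of 1] show "\<forall>\<^sub>F t in at_top. f t / ereal t < c"
    proof eventually_elim
      case (elim t)
      obtain a b where ab: "(a, b) \<in> affine_minorants f" "ereal (a * t + b) = f t"
        using ex_tangent[OF interior[OF elim(1)]] by auto
      have "ereal (a * 1 + b) \<le> f 1" using ab(1) unfolding affine_minorants_def by blast
      then have "a * t + b \<le> a * (t - 1)" by (simp add: at_one algebra_simps zero_ereal_def)
      also have "\<dots> \<le> \<sigma> * (t - 1)"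
        using upper[OF ab(1)] \<sigma> elim(1) by (intro mult_right_mono) auto
      finally have "(a * t + b) / t \<le> \<sigma> * (t - 1) / t"
        using elim(1) by (intro divide_right_mono) auto
      also have "\<dots> = \<sigma> - \<sigma> / t"
        using elim(1) by (simp add: field_simps)
      finally have "(a * t + b) / t \<le> \<sigma> - \<sigma> / t" .
      moreover have "f t / ereal t = ereal ((a * t + b) / t)"
        using ab(2)[symmetric] elim(1) by simp
      ultimately show ?case using elim(2) by (metis ereal_less_eq(3) le_less_trans)
    qed
  qed
  then show ?thesis
    unfolding adjoint_at_0_def S_def by (intro tendsto_Lim) auto
qed

lemma ex_rational_slope_above:
  assumes "ereal c < adjoint_at_0 f"
  shows "\<exists>(a, b)\<in>affine_minorants f \<inter> \<rat> \<times> \<rat>. c < a"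
proof -
  obtain a b where "(a, b) \<in> affine_minorants f" "c < a"
    using assms unfolding adjoint_eq_Sup_slopes less_SUP_iff by auto
  from ex_rational_minorant[OF this(1), of 1 "a + b - 1" c] this(2) show ?thesis by auto
qed

lemma slope_le_adjoint: "(a, b) \<in> affine_minorants f \<Longrightarrow> ereal a \<le> adjoint_at_0 f"
  unfolding adjoint_eq_Sup_slopes by (auto intro!: SUP_upper2[of "(a, b)"])

text \<open>
The two alternatives distinguish the right and the left endpoint of the domain. They are what
replaces a tangent at an endpoint: if a divergence is finite, then almost every
likelihood ratio lies on one side of the endpoint.
\<close>

lemma frontier_eff_dom_cases:
  assumes e: "e \<in> frontier (eff_dom f)"
  shows "(\<forall>t>e. f t = \<infinity>) \<and> adjoint_at_0 f = \<infinity> \<or> (\<forall>t<e. f t = \<infinity>)"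
proof -
  have seg: False if "t \<in> eff_dom f" "e \<in> open_segment 1 t" for t
    using in_interior_closure_convex_segment[OF convex_eff_dom one_in_interior, of t] that e
      closure_subset[of "eff_dom f"] by (auto simp: frontier_def)
  have "e \<noteq> 1" using e one_in_interior by (auto simp: frontier_def)
  then consider "1 < e" | "e < 1" by linarith
  then show ?thesis
  proof cases
    case 1
    have sub: "eff_dom f \<subseteq> {..e}"
    proof
      fix t assume "t \<in> eff_dom f"
      then show "t \<in> {..e}"
        using seg[of t] 1 by (cases "e < t") (auto simp: open_segment_eq_real_ivl)
    qed
    have "adjoint_at_0 f = \<infinity>"
    proof (rule ereal_top)
      fix c
      from ex_steep_up[OF sub, of c 0] obtain a b where "(a, b) \<in> affine_minorants f" "c < a" by auto
      then show "ereal c \<le> adjoint_at_0 f"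
        using slope_le_adjoint[of a b] by (auto intro: order_trans[of _ "ereal a"])
    qed
    moreover have "f t = \<infinity>" if "t > e" for t
      using sub that by (intro off_eff_dom) auto
    ultimately show ?thesis by blast
  next
    case 2
    then have "f t = \<infinity>" if "t < e" for t
      using seg[of t] that by (intro off_eff_dom) (auto simp: open_segment_eq_real_ivl)
    then show ?thesis by blast
  qed
qed

lemma countable_frontier_eff_dom: "countable (frontier (eff_dom f))"
proof -
  have seg: False if "x \<in> frontier (eff_dom f)" "y \<in> frontier (eff_dom f)" "y \<in> open_segment 1 x" for x y
    using in_interior_closure_convex_segment[OF convex_eff_dom one_in_interior, of x] that
    by (auto simp: frontier_def)
  have at_most_one: "countable A" if "\<And>x y. x \<in> A \<Longrightarrow> y \<in> A \<Longrightarrow> x = y" for A :: "real set"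
  proof (cases "A = {}")
    case False
    then obtain x where "x \<in> A" by blast
    with that have "A = {x}" by blast
    then show ?thesis by simp
  qed simp
  have one: "x = y" if "x \<in> frontier (eff_dom f)" "y \<in> frontier (eff_dom f)" "(x < 1) = (y < 1)"
      "x \<noteq> 1" "y \<noteq> 1" for x y
    using that seg[of x y] seg[of y x] by (cases x y rule: linorder_cases) (force simp: open_segment_eq_real_ivl split: if_splits)+
  have "frontier (eff_dom f) = (frontier (eff_dom f) \<inter> {..<1}) \<union> (frontier (eff_dom f) \<inter> {1<..})"
    using one_in_interior by (auto simp: frontier_def) (metis linorder_neqE_linordered_idom)
  moreover have "countable (frontier (eff_dom f) \<inter> {..<1})" "countable (frontier (eff_dom f) \<inter> {1<..})"
    using one by (auto intro!: at_most_one)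
  ultimately show ?thesis by (metis countable_Un)
qed

end

section \<open>Perspectives and Markov kernels\<close>

text \<open>
The bounds are applied on complementary parts of each set, so they have to hold for all sets;
this is why they are stated in the order on measures.
\<close>

lemma density_max_le:
  assumes [measurable]: "h \<in> borel_measurable M" "k \<in> borel_measurable M"
    and G: "sets G = sets M" "density M h \<le> G" "density M k \<le> G"
  shows "density M (\<lambda>x. max (h x) (k x)) \<le> G"
proof -
  note sets_G [simp] = G(1)
  have "emeasure (density M (\<lambda>x. max (h x) (k x))) A \<le> emeasure G A" if [measurable]: "A \<in> sets M" for A
  proof -
    define B where "B = {x \<in> A. h x \<le> k x}"
    have [measurable]: "B \<in> sets M"
      unfolding B_def using sets.sets_into_space[OF that] by (auto intro!: sets_Collect_single')
    have "emeasure (density M (\<lambda>x. max (h x) (k x))) A =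
        (\<integral>\<^sup>+x. k x * indicator B x + h x * indicator (A - B) x \<partial>M)"
      by (subst emeasure_density)
        (auto intro!: nn_integral_cong simp: B_def indicator_def max_def split: if_splits)
    also have "\<dots> = emeasure (density M k) B + emeasure (density M h) (A - B)"
      by (subst nn_integral_add) (auto simp: emeasure_density)
    also have "\<dots> \<le> emeasure G B + emeasure G (A - B)"
      using G by (intro add_mono) (auto simp: le_measure)
    also have "\<dots> = emeasure G (B \<union> (A - B))"
      by (intro plus_emeasure) auto
    also have "B \<union> (A - B) = A"
      by (auto simp: B_def)
    finally show ?thesis .
  qed
  then show ?thesis
    by (simp add: le_measure)
qed

lemma density_SUP_le:
  assumes "countable I" and meas: "\<And>i. i \<in> I \<Longrightarrow> h i \<in> borel_measurable M"
    and G: "sets G = sets M" "\<And>i. i \<in> I \<Longrightarrow> density M (h i) \<le> G"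
  shows "density M (\<lambda>x. SUP i\<in>I. h i x) \<le> G"
proof (cases "I = {}")
  case True
  then show ?thesis
    using G(1) by (simp add: le_measure emeasure_density bot_ennreal)
next
  case False
  define \<phi> where "\<phi> = from_nat_into I"
  have \<phi>: "range \<phi> = I"
    unfolding \<phi>_def using False assms(1) by (rule range_from_nat_into)
  then have \<phi>_in: "\<phi> n \<in> I" for n
    by auto
  define m where "m n x = Max ((\<lambda>i. h (\<phi> i) x) ` {..n})" for n x
  have m_0: "m 0 = h (\<phi> 0)" and m_Suc: "m (Suc n) = (\<lambda>x. max (h (\<phi> (Suc n)) x) (m n x))" for n
    by (auto simp: m_def fun_eq_iff atMost_Suc)
  have m: "m n \<in> borel_measurable M \<and> density M (m n) \<le> G" for n
  proof (induction n)
    case 0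
    then show ?case using meas G \<phi>_in by (simp add: m_0)
  next
    case (Suc n)
    then show ?case
      unfolding m_Suc using meas[OF \<phi>_in] G(1) G(2)[OF \<phi>_in] by (auto intro!: density_max_le)
  qed
  then have [measurable]: "m n \<in> borel_measurable M" for n
    by blast
  have inc: "incseq m"
    by (rule incseq_SucI) (simp add: m_Suc le_fun_def)
  have SUP: "(SUP i\<in>I. h i x) = (SUP n. m n x)" for x
  proof (rule antisym)
    show "(SUP i\<in>I. h i x) \<le> (SUP n. m n x)"
      unfolding \<phi>[symmetric] image_image by (intro SUP_mono) (auto simp: m_def intro!: Max_ge)
    show "(SUP n. m n x) \<le> (SUP i\<in>I. h i x)"
      using \<phi>_in by (intro SUP_least) (auto simp: m_def intro: SUP_upper)
  qed
  have "emeasure (density M (\<lambda>x. SUP i\<in>I. h i x)) A \<le> emeasure G A" if [measurable]: "A \<in> sets M" for A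
  proof -
    have "emeasure (density M (\<lambda>x. SUP i\<in>I. h i x)) A = (\<integral>\<^sup>+x. (SUP n. m n x * indicator A x) \<partial>M)"
      by (simp add: SUP emeasure_density SUP_mult_right_ennreal)
    also have "\<dots> = (SUP n. \<integral>\<^sup>+x. m n x * indicator A x \<partial>M)"
      using inc by (intro nn_integral_monotone_convergence_SUP)
        (auto simp: incseq_def le_fun_def intro!: mult_right_mono)
    also have "\<dots> = (SUP n. emeasure (density M (m n)) A)"
      by (simp add: emeasure_density)
    also have "\<dots> \<le> emeasure G A"
      using m G(1) by (intro SUP_least) (simp add: le_measure)
    finally show ?thesis .
  qed
  then show ?thesis
    using G(1) by (simp add: le_measure)
qed

text \<open>
The homogeneous form of the integrand of a divergence: its integral for a dominating measure and
two densities is \<open>\<integral> g (p / q) \<partial>Q\<close> plus \<open>slope\<close> times the mass of \<open>P\<close> where \<open>q\<close> vanishes.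
\<close>

definition perspective :: "(real \<Rightarrow> ennreal) \<Rightarrow> ennreal \<Rightarrow> real \<Rightarrow> real \<Rightarrow> ennreal" where
  "perspective g slope p q = (if q = 0 then slope * ennreal p else ennreal q * g (p / q))"

text \<open>
What the data processing inequality uses of a nonnegative convex function \<open>g\<close> on \<open>{0..}\<close>:
a countable set \<open>C\<close> of affine minorants whose supremum is \<open>g\<close> except possibly on a countable set
\<open>E\<close>, and whose slopes have as supremum the slope of \<open>g\<close> at infinity. On one side of an
exceptional point \<open>g\<close> must be infinite. Minorants enter through \<^const>\<open>ennreal\<close>, hence as their positive
parts.
\<close>

locale supported_function =
  fixes g :: "real \<Rightarrow> ennreal" and slope :: ennreal
    and C :: "(real \<times> real) set" and E :: "real set"
  assumes countable_C: "countable C" and countable_E: "countable E"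
    and minorant: "\<And>a b t. (a, b) \<in> C \<Longrightarrow> 0 \<le> t \<Longrightarrow> ennreal (a * t + b) \<le> g t"
    and slope_minorant: "\<And>a b. (a, b) \<in> C \<Longrightarrow> ennreal a \<le> slope"
    and le_SUP_minorants: "\<And>t. 0 \<le> t \<Longrightarrow> t \<notin> E \<Longrightarrow> g t \<le> (SUP (a, b)\<in>C. ennreal (a * t + b))"
    and slope_le_SUP: "slope \<le> (SUP (a, b)\<in>C. ennreal a)"
    and jump: "\<And>e. e \<in> E \<Longrightarrow> (\<forall>t>e. g t = \<infinity>) \<and> slope = \<infinity> \<or> (\<forall>t. 0 \<le> t \<and> t < e \<longrightarrow> g t = \<infinity>)"
begin

abbreviation persp :: "real \<Rightarrow> real \<Rightarrow> ennreal" where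
  "persp \<equiv> perspective g slope"

text \<open>
Adding to the linear functions that belong to \<open>C\<close> the restrictions of the perspective
to the rays \<open>p = e * q\<close> gives a countable family whose supremum is the perspective everywhere,
jumps at the endpoints included. It therefore suffices to prove the data processing
inequality for each member of the family.
\<close>

definition supports :: "(real \<Rightarrow> real \<Rightarrow> ennreal) set" where
  "supports = (\<lambda>(a, b) p q. ennreal (a * p + b * q)) ` C \<union>
     (\<lambda>e p q. if p = e * q then ennreal q * g e else 0) ` E"

lemma linear_le_persp:
  assumes "(a, b) \<in> C" "p \<ge> 0" "q \<ge> 0"
  shows "ennreal (a * p + b * q) \<le> persp p q"
proof (cases "q = 0")
  case True
  then show ?thesis
    using slope_minorant[OF assms(1)] assms(2) by (simp add: perspective_def ennreal_mult'' mult_right_mono)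
next
  case False
  then have "ennreal (a * p + b * q) = ennreal q * ennreal (a * (p / q) + b)"
    using assms(3) by (simp flip: ennreal_mult' add: distrib_left mult.commute)
  also have "\<dots> \<le> ennreal q * g (p / q)"
    using assms by (intro mult_left_mono minorant) auto
  finally show ?thesis
    using False by (simp add: perspective_def)
qed

lemma persp_on_ray: "persp (e * q) q = ennreal q * g e"
  by (simp add: perspective_def)

lemma persp_eq_SUP:
  assumes "p \<ge> 0" "q \<ge> 0"
  shows "persp p q = (SUP h\<in>supports. h p q)"
proof (rule antisym)
  show "(SUP h\<in>supports. h p q) \<le> persp p q"
    using assms by (auto simp: supports_def persp_on_ray intro!: SUP_least linear_le_persp)
  have C: "ennreal (a * p + b * q) \<le> (SUP h\<in>supports. h p q)" if "(a, b) \<in> C" for a b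
    by (rule SUP_upper2[of "\<lambda>p q. ennreal (a * p + b * q)"]) (use that in \<open>force simp: supports_def\<close>)+
  show "persp p q \<le> (SUP h\<in>supports. h p q)"
  proof (cases "q = 0")
    case True
    have "persp p q \<le> (SUP (a, b)\<in>C. ennreal a) * ennreal p"
      using True slope_le_SUP by (simp add: perspective_def mult_right_mono)
    also have "\<dots> = (SUP (a, b)\<in>C. ennreal (a * p + b * q))"
      using True assms(1) by (simp add: SUP_mult_right_ennreal ennreal_mult'' case_prod_beta)
    also have "\<dots> \<le> (SUP h\<in>supports. h p q)"
      using C by (auto intro!: SUP_least)
    finally show ?thesis .
  next
    case False
    then have q: "q > 0" using assms by simp
    show ?thesis
    proof (cases "p / q \<in> E")
      case True
      then have "(\<lambda>p' q'. if p' = p / q * q' then ennreal q' * g (p / q) else 0) \<in> supports"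
        unfolding supports_def by (intro UnI2 imageI)
      then show ?thesis
        using q by (intro SUP_upper2) (auto simp: perspective_def)
    next
      case notE: False
      have "persp p q \<le> ennreal q * (SUP (a, b)\<in>C. ennreal (a * (p / q) + b))"
        using q assms le_SUP_minorants[OF _ notE] by (simp add: perspective_def mult_left_mono)
      also have "\<dots> = (SUP (a, b)\<in>C. ennreal (a * p + b * q))"
        using q by (simp add: SUP_mult_left_ennreal case_prod_beta distrib_left mult.commute flip: ennreal_mult')
      also have "\<dots> \<le> (SUP h\<in>supports. h p q)"
        using C by (auto intro!: SUP_least)
      finally show ?thesis .
    qed
  qed
qed

lemma countable_supports: "countable supports"
  unfolding supports_def using countable_C countable_E by simp

lemma measurable_supports:
  assumes "h \<in> supports" and [measurable]: "p \<in> borel_measurable M" "q \<in> borel_measurable M"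
  shows "(\<lambda>x. h (p x) (q x)) \<in> borel_measurable M"
  using assms(1) unfolding supports_def by auto

lemma measurable_persp:
  assumes [measurable]: "p \<in> borel_measurable M" "q \<in> borel_measurable M"
    and nonneg: "\<And>x. p x \<ge> 0" "\<And>x. q x \<ge> 0"
  shows "(\<lambda>x. persp (p x) (q x)) \<in> borel_measurable M"
  unfolding persp_eq_SUP[OF nonneg]
  using measurable_supports[OF _ assms(1,2)] by (intro borel_measurable_SUP countable_supports)

text \<open>
Whether the sign is the same for all \<open>(p, q)\<close> matters: it makes the integral of \<open>p - e * q\<close> a
test for \<open>p = e * q\<close>.
\<close>

lemma on_one_side_of_jump:
  assumes e: "e \<in> E"
  shows "(\<forall>p q. 0 \<le> p \<and> 0 \<le> q \<and> persp p q \<noteq> \<infinity> \<longrightarrow> p \<le> e * q) \<or>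
         (\<forall>p q. 0 \<le> p \<and> 0 \<le> q \<and> persp p q \<noteq> \<infinity> \<longrightarrow> e * q \<le> p)"
  using jump[OF e]
proof
  assume *: "(\<forall>t>e. g t = \<infinity>) \<and> slope = \<infinity>"
  have "p \<le> e * q" if "0 \<le> p" "0 \<le> q" "persp p q \<noteq> \<infinity>" for p q
  proof (rule ccontr)
    assume "\<not> p \<le> e * q"
    then have "persp p q = \<infinity>"
      unfolding perspective_def using * that(1,2)
      by (cases "q = 0") (auto simp: ennreal_mult_top ennreal_top_mult field_simps)
    with that(3) show False by simp
  qed
  then show ?thesis by blast
next
  assume *: "\<forall>t. 0 \<le> t \<and> t < e \<longrightarrow> g t = \<infinity>"
  have "e * q \<le> p" if "0 \<le> p" "0 \<le> q" "persp p q \<noteq> \<infinity>" for p q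
  proof (rule ccontr)
    assume "\<not> e * q \<le> p"
    then have "persp p q = \<infinity>"
      using * that(1,2) by (cases "q = 0") (auto simp: perspective_def ennreal_mult_top field_simps)
    with that(3) show False by simp
  qed
  then show ?thesis by blast
qed

end

lemma ennreal_integral_le_nn_integral:
  assumes [measurable]: "integrable M f"
  shows "ennreal (integral\<^sup>L M f) \<le> (\<integral>\<^sup>+x. ennreal (f x) \<partial>M)"
proof -
  have "ennreal (integral\<^sup>L M f) \<le> ennreal (\<integral>x. max 0 (f x) \<partial>M)"
    using assms by (intro ennreal_leI integral_mono) auto
  also have "\<dots> = (\<integral>\<^sup>+x. ennreal (max 0 (f x)) \<partial>M)"
    using assms by (intro nn_integral_eq_integral[symmetric]) auto
  finally show ?thesis
    by (simp add: ennreal_max_0)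
qed

text \<open>
The mass that a kernel transports into a set \<open>A\<close> is the integral of the density of the source
against the weight \<open>measure (L x) A\<close>. With real-valued densities this relation survives
taking linear combinations with coefficients of either sign.
\<close>

lemma integral_density_bind:
  fixes p p' :: "_ \<Rightarrow> real"
  assumes L [measurable]: "L \<in> measurable \<mu> (prob_algebra N)" and sets\<nu> [measurable_cong]: "sets \<nu> = sets N"
    and [measurable]: "p \<in> borel_measurable \<mu>" "p' \<in> borel_measurable \<nu>"
    and nonneg: "\<And>x. p x \<ge> 0" "\<And>y. p' y \<ge> 0"
    and fin: "finite_measure (density \<mu> p)"
    and bind: "density \<nu> p' = density \<mu> p \<bind> L" and ne: "space \<mu> \<noteq> {}"
    and A: "A \<in> sets N"
  shows "integrable \<mu> (\<lambda>x. measure (L x) A * p x)" "integrable \<nu> (\<lambda>y. indicator A y * p' y)"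
    and "(\<integral>y. indicator A y * p' y \<partial>\<nu>) = (\<integral>x. measure (L x) A * p x \<partial>\<mu>)"
    and "(\<integral>\<^sup>+y. indicator A y * ennreal (p' y) \<partial>\<nu>) = (\<integral>\<^sup>+x. ennreal (measure (L x) A) * ennreal (p x) \<partial>\<mu>)"
proof -
  have [measurable]: "A \<in> sets \<nu>" using A sets\<nu> by simp
  have [measurable]: "(\<lambda>x. measure (L x) A) \<in> borel_measurable \<mu>"
    using L A by measurable
  have prob: "prob_space (L x)" if "x \<in> space \<mu>" for x
    using measurable_space[OF L that] by (simp add: space_prob_algebra)
  have em: "emeasure (L x) A = ennreal (measure (L x) A)" if "x \<in> space \<mu>" for x
    using prob_space.finite_measure[OF prob[OF that]] by (rule finite_measure.emeasure_eq_measure)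
  have "(\<integral>\<^sup>+y. indicator A y * ennreal (p' y) \<partial>\<nu>) = emeasure (density \<nu> p') A"
    by (subst emeasure_density) (auto simp: mult.commute)
  also have "\<dots> = (\<integral>\<^sup>+x. emeasure (L x) A \<partial>density \<mu> p)"
    unfolding bind using ne A L by (intro emeasure_bind) (auto intro: measurable_prob_algebraD)
  also have "\<dots> = (\<integral>\<^sup>+x. ennreal (measure (L x) A) \<partial>density \<mu> p)"
    by (intro nn_integral_cong) (simp add: em)
  also have "\<dots> = (\<integral>\<^sup>+x. ennreal (measure (L x) A) * ennreal (p x) \<partial>\<mu>)"
    by (subst nn_integral_density) (auto simp: mult.commute)
  finally show eq: "(\<integral>\<^sup>+y. indicator A y * ennreal (p' y) \<partial>\<nu>) =
    (\<integral>\<^sup>+x. ennreal (measure (L x) A) * ennreal (p x) \<partial>\<mu>)" .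
  have "(\<integral>\<^sup>+x. ennreal (measure (L x) A) * ennreal (p x) \<partial>\<mu>) \<le> (\<integral>\<^sup>+x. ennreal (p x) \<partial>\<mu>)"
  proof (intro nn_integral_mono)
    fix x assume "x \<in> space \<mu>"
    then have "ennreal (measure (L x) A) \<le> 1"
      using prob_space.prob_le_1[OF prob] by simp
    from mult_right_mono[OF this, of "ennreal (p x)"]
    show "ennreal (measure (L x) A) * ennreal (p x) \<le> ennreal (p x)" by simp
  qed
  also have "\<dots> = emeasure (density \<mu> p) (space \<mu>)"
    by (subst emeasure_density) (auto intro!: nn_integral_cong)
  also have "\<dots> < \<infinity>"
    using finite_measure.emeasure_finite[OF fin] by (simp add: less_top)
  finally have lt: "(\<integral>\<^sup>+x. ennreal (measure (L x) A) * ennreal (p x) \<partial>\<mu>) < \<infinity>" .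
  show "integrable \<mu> (\<lambda>x. measure (L x) A * p x)"
    using lt nonneg by (intro integrableI_nonneg) (auto simp: ennreal_mult)
  show "integrable \<nu> (\<lambda>y. indicator A y * p' y)"
    using lt nonneg unfolding eq[symmetric]
    by (intro integrableI_nonneg) (auto simp: ennreal_mult ennreal_indicator)
  show "(\<integral>y. indicator A y * p' y \<partial>\<nu>) = (\<integral>x. measure (L x) A * p x \<partial>\<mu>)"
    using eq nonneg by (subst (1 2) integral_eq_nn_integral) (auto simp: ennreal_mult ennreal_indicator)
qed

context supported_function
begin

text \<open>
The data processing inequality in a localized form: the measure with density \<open>persp p' q'\<close> lies
below the image under the kernel of the measure with density \<open>persp p q\<close>. Stated for all sets
instead of for the whole space only, it passes from the members of \<^const>\<open>supports\<close> to their
supremum.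

A linear member commutes with the kernel, so for it the claim is the bound of a linear
function by the perspective under the integral. For a member on the ray through \<open>e\<close> let \<open>B\<close> be a set
on which \<open>p' = e * q'\<close>. Then the integral of \<open>p - e * q\<close> against the weight \<open>measure (L x) B\<close>
vanishes, while by finiteness of the total integral the integrand has constant sign. Hence \<open>B\<close>
receives mass only from points with \<open>p = e * q\<close>, where the perspective is \<open>q * g e\<close> as well.
\<close>

lemma density_persp_bind:
  fixes p q :: "'a \<Rightarrow> real" and p' q' :: "'b \<Rightarrow> real"
  assumes L [measurable]: "L \<in> measurable \<mu> (prob_algebra N)" and ne: "space \<mu> \<noteq> {}"
    and sets\<nu> [measurable_cong]: "sets \<nu> = sets N"
    and [measurable]: "p \<in> borel_measurable \<mu>" "q \<in> borel_measurable \<mu>"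
      "p' \<in> borel_measurable \<nu>" "q' \<in> borel_measurable \<nu>"
    and nonneg: "\<And>x. p x \<ge> 0" "\<And>x. q x \<ge> 0" "\<And>y. p' y \<ge> 0" "\<And>y. q' y \<ge> 0"
    and fin: "finite_measure (density \<mu> p)" "finite_measure (density \<mu> q)"
    and bind: "density \<nu> p' = density \<mu> p \<bind> L" "density \<nu> q' = density \<mu> q \<bind> L"
    and finite: "(\<integral>\<^sup>+x. persp (p x) (q x) \<partial>\<mu>) < \<infinity>"
  shows "density \<nu> (\<lambda>y. persp (p' y) (q' y)) \<le> density \<mu> (\<lambda>x. persp (p x) (q x)) \<bind> L"
    (is "_ \<le> ?G")
proof -
  note tp = integral_density_bind[OF L sets\<nu> _ _ nonneg(1,3) fin(1) bind(1) ne]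
  note tq = integral_density_bind[OF L sets\<nu> _ _ nonneg(2,4) fin(2) bind(2) ne]
  have [measurable]: "(\<lambda>x. persp (p x) (q x)) \<in> borel_measurable \<mu>"
    using nonneg by (intro measurable_persp) auto
  have w [measurable]: "(\<lambda>x. measure (L x) A) \<in> borel_measurable \<mu>" if [measurable]: "A \<in> sets N" for A
    by measurable
  have em: "emeasure (L x) A = ennreal (measure (L x) A)" if "x \<in> space \<mu>" for x A
    using measurable_space[OF L that]
    by (auto simp: space_prob_algebra finite_measure.emeasure_eq_measure prob_space.finite_measure)
  have Lsub: "L \<in> measurable (density \<mu> k) (subprob_algebra N)" for k
    using measurable_prob_algebraD[OF L] by simp
  have G: "emeasure ?G A = (\<integral>\<^sup>+x. ennreal (measure (L x) A) * persp (p x) (q x) \<partial>\<mu>)"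
    if [measurable]: "A \<in> sets N" for A
  proof -
    have "emeasure ?G A = (\<integral>\<^sup>+x. emeasure (L x) A \<partial>density \<mu> (\<lambda>x. persp (p x) (q x)))"
      using ne by (intro emeasure_bind[OF _ Lsub]) auto
    also have "\<dots> = (\<integral>\<^sup>+x. ennreal (measure (L x) A) \<partial>density \<mu> (\<lambda>x. persp (p x) (q x)))"
      by (intro nn_integral_cong) (simp add: em)
    finally show ?thesis
      by (simp add: nn_integral_density mult.commute)
  qed
  have setsG: "sets ?G = sets \<nu>"
    using ne sets\<nu> sets_bind[of "density \<mu> (\<lambda>x. persp (p x) (q x))" L N] subprob_measurableD(2)[OF Lsub]
    by auto
  have "density \<nu> (\<lambda>y. SUP h\<in>supports. h (p' y) (q' y)) \<le> ?G"
  proof (rule density_SUP_le[OF countable_supports _ setsG])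
    fix h assume h: "h \<in> supports"
    show [measurable]: "(\<lambda>y. h (p' y) (q' y)) \<in> borel_measurable \<nu>"
      using h by (rule measurable_supports) auto
    have "(\<integral>\<^sup>+y. h (p' y) (q' y) * indicator A y \<partial>\<nu>) \<le> emeasure ?G A" if A [measurable]: "A \<in> sets N" for A
    proof -
      have [measurable]: "A \<in> sets \<nu>" using A sets\<nu> by simp
      have sp: "space \<nu> = space N" using sets\<nu> by (rule sets_eq_imp_space_eq)
      from h consider (linear) a b where "(a, b) \<in> C" "h = (\<lambda>p q. ennreal (a * p + b * q))"
        | (ray) e where "e \<in> E" "h = (\<lambda>p q. if p = e * q then ennreal q * g e else 0)"
        by (auto simp: supports_def)
      then show ?thesis
      proof cases
        case linear
        \<comment> \<open>Restricting to the set where the function is nonnegative turns its positive part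
          into the function itself.\<close>
        define B where "B = {y \<in> space N. y \<in> A \<and> 0 \<le> a * p' y + b * q' y}"
        have B [measurable]: "B \<in> sets N"
          unfolding B_def using sp by measurable
        have "(\<integral>\<^sup>+y. h (p' y) (q' y) * indicator A y \<partial>\<nu>) =
            (\<integral>\<^sup>+y. ennreal (a * (indicator B y * p' y) + b * (indicator B y * q' y)) \<partial>\<nu>)"
          unfolding linear by (intro nn_integral_cong) (auto simp: B_def sp indicator_def ennreal_neg)
        also have "\<dots> = ennreal (\<integral>y. a * (indicator B y * p' y) + b * (indicator B y * q' y) \<partial>\<nu>)"
          using tp(2)[OF _ _ B] tq(2)[OF _ _ B]
          by (intro nn_integral_eq_integral) (auto simp: B_def indicator_def)
        also have "(\<integral>y. a * (indicator B y * p' y) + b * (indicator B y * q' y) \<partial>\<nu>) =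
            (\<integral>x. a * (measure (L x) B * p x) + b * (measure (L x) B * q x) \<partial>\<mu>)"
          using tp[OF _ _ B] tq[OF _ _ B] by simp
        also have "ennreal \<dots> \<le> (\<integral>\<^sup>+x. ennreal (a * (measure (L x) B * p x) + b * (measure (L x) B * q x)) \<partial>\<mu>)"
          using tp(1)[OF _ _ B] tq(1)[OF _ _ B] by (intro ennreal_integral_le_nn_integral) auto
        also have "\<dots> = (\<integral>\<^sup>+x. ennreal (measure (L x) B) * ennreal (a * p x + b * q x) \<partial>\<mu>)"
          by (intro nn_integral_cong) (simp add: algebra_simps flip: ennreal_mult')
        also have "\<dots> \<le> (\<integral>\<^sup>+x. ennreal (measure (L x) A) * persp (p x) (q x) \<partial>\<mu>)"
        proof (intro nn_integral_mono mult_mono)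
          fix x assume x: "x \<in> space \<mu>"
          show "ennreal (measure (L x) B) \<le> ennreal (measure (L x) A)"
            unfolding em[OF x, symmetric] using measurable_space[OF L x] A
            by (intro emeasure_mono) (auto simp: B_def space_prob_algebra)
        qed (use linear nonneg linear_le_persp in auto)
        finally show ?thesis using G[OF A] by simp
      next
        case ray
        define B where "B = {y \<in> space N. y \<in> A \<and> p' y = e * q' y}"
        have B [measurable]: "B \<in> sets N"
          unfolding B_def using sp by measurable
        have int: "integrable \<mu> (\<lambda>x. measure (L x) B * p x)" "integrable \<mu> (\<lambda>x. e * (measure (L x) B * q x))"
          using tp(1)[OF _ _ B] tq(1)[OF _ _ B] by auto
        have "(\<integral>x. measure (L x) B * p x \<partial>\<mu>) = (\<integral>y. indicator B y * p' y \<partial>\<nu>)"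
          using tp(3)[OF _ _ B] by simp
        also have "\<dots> = (\<integral>y. e * (indicator B y * q' y) \<partial>\<nu>)"
          by (intro Bochner_Integration.integral_cong) (auto simp: B_def indicator_def)
        also have "\<dots> = (\<integral>x. e * (measure (L x) B * q x) \<partial>\<mu>)"
          using tq(3)[OF _ _ B] by simp
        finally have eq: "(\<integral>x. measure (L x) B * p x \<partial>\<mu>) = (\<integral>x. e * (measure (L x) B * q x) \<partial>\<mu>)" .
        have AEfin: "AE x in \<mu>. persp (p x) (q x) \<noteq> \<infinity>"
          using finite by (intro nn_integral_PInf_AE) auto
        have ord: "(AE x in \<mu>. measure (L x) B * p x \<le> e * (measure (L x) B * q x)) \<or>
            (AE x in \<mu>. e * (measure (L x) B * q x) \<le> measure (L x) B * p x)"
          using on_one_side_of_jump[OF ray(1)]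
        proof (elim disj_forward)
          assume *: "\<forall>p q. 0 \<le> p \<and> 0 \<le> q \<and> persp p q \<noteq> \<infinity> \<longrightarrow> p \<le> e * q"
          show "AE x in \<mu>. measure (L x) B * p x \<le> e * (measure (L x) B * q x)"
            using AEfin
          proof eventually_elim
            case (elim x)
            then have "measure (L x) B * p x \<le> measure (L x) B * (e * q x)"
              using * nonneg by (intro mult_left_mono) auto
            then show ?case by (simp add: mult_ac)
          qed
        next
          assume *: "\<forall>p q. 0 \<le> p \<and> 0 \<le> q \<and> persp p q \<noteq> \<infinity> \<longrightarrow> e * q \<le> p"
          show "AE x in \<mu>. e * (measure (L x) B * q x) \<le> measure (L x) B * p x"
            using AEfin
          proof eventually_elim
            case (elim x)
            then have "measure (L x) B * (e * q x) \<le> measure (L x) B * p x"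
              using * nonneg by (intro mult_left_mono) auto
            then show ?case by (simp add: mult_ac)
          qed
        qed
        have AEeq: "AE x in \<mu>. measure (L x) B * p x = e * (measure (L x) B * q x)"
          using ord
        proof
          assume "AE x in \<mu>. measure (L x) B * p x \<le> e * (measure (L x) B * q x)"
          from integral_ineq_eq_0_then_AE[OF this int eq] show ?thesis .
        next
          assume "AE x in \<mu>. e * (measure (L x) B * q x) \<le> measure (L x) B * p x"
          from integral_ineq_eq_0_then_AE[OF this int(2,1) eq[symmetric]] show ?thesis
            by eventually_elim (rule sym)
        qed
        have "(\<integral>\<^sup>+y. h (p' y) (q' y) * indicator A y \<partial>\<nu>) = (\<integral>\<^sup>+y. g e * (indicator B y * ennreal (q' y)) \<partial>\<nu>)"
          unfolding ray by (intro nn_integral_cong) (auto simp: B_def sp indicator_def mult_ac)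
        also have "\<dots> = g e * (\<integral>\<^sup>+x. ennreal (measure (L x) B) * ennreal (q x) \<partial>\<mu>)"
          using tq(4)[OF _ _ B] by (subst nn_integral_cmult) auto
        also have "\<dots> = (\<integral>\<^sup>+x. g e * (ennreal (measure (L x) B) * ennreal (q x)) \<partial>\<mu>)"
          by (subst nn_integral_cmult) auto
        also have "\<dots> = (\<integral>\<^sup>+x. ennreal (measure (L x) B) * persp (p x) (q x) \<partial>\<mu>)"
        proof (rule nn_integral_cong_AE)
          show "AE x in \<mu>. g e * (ennreal (measure (L x) B) * ennreal (q x)) =
              ennreal (measure (L x) B) * persp (p x) (q x)"
            using AEeq
          proof eventually_elim
            case (elim x)
            then show ?case
            proof (cases "measure (L x) B = 0")
              case False
              with elim have "p x = e * q x" by (simp add: mult.left_commute[of e])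
              then show ?thesis by (simp add: persp_on_ray mult_ac)
            qed simp
          qed
        qed
        also have "\<dots> \<le> (\<integral>\<^sup>+x. ennreal (measure (L x) A) * persp (p x) (q x) \<partial>\<mu>)"
        proof (intro nn_integral_mono mult_right_mono)
          fix x assume x: "x \<in> space \<mu>"
          show "ennreal (measure (L x) B) \<le> ennreal (measure (L x) A)"
            unfolding em[OF x, symmetric] using measurable_space[OF L x] A
            by (intro emeasure_mono) (auto simp: B_def space_prob_algebra)
        qed simp
        finally show ?thesis using G[OF A] by simp
      qed
    qed
    then show "density \<nu> (\<lambda>y. h (p' y) (q' y)) \<le> ?G"
      using setsG sets\<nu> by (auto simp: le_measure emeasure_density)
  qed
  then show ?thesis
    by (simp add: persp_eq_SUP nonneg)
qed

theorem nn_integral_persp_bind_le: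
  fixes p q :: "'a \<Rightarrow> real" and p' q' :: "'b \<Rightarrow> real"
  assumes L [measurable]: "L \<in> measurable \<mu> (prob_algebra N)" and ne: "space \<mu> \<noteq> {}"
    and sets\<nu> [measurable_cong]: "sets \<nu> = sets N"
    and [measurable]: "p \<in> borel_measurable \<mu>" "q \<in> borel_measurable \<mu>"
      "p' \<in> borel_measurable \<nu>" "q' \<in> borel_measurable \<nu>"
    and nonneg: "\<And>x. p x \<ge> 0" "\<And>x. q x \<ge> 0" "\<And>y. p' y \<ge> 0" "\<And>y. q' y \<ge> 0"
    and fin: "finite_measure (density \<mu> p)" "finite_measure (density \<mu> q)"
    and bind: "density \<nu> p' = density \<mu> p \<bind> L" "density \<nu> q' = density \<mu> q \<bind> L"
  shows "(\<integral>\<^sup>+y. persp (p' y) (q' y) \<partial>\<nu>) \<le> (\<integral>\<^sup>+x. persp (p x) (q x) \<partial>\<mu>)"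
proof (cases "(\<integral>\<^sup>+x. persp (p x) (q x) \<partial>\<mu>) < \<infinity>")
  case True
  have [measurable]: "(\<lambda>x. persp (p x) (q x)) \<in> borel_measurable \<mu>"
      "(\<lambda>y. persp (p' y) (q' y)) \<in> borel_measurable \<nu>"
    using nonneg by (intro measurable_persp; simp)+
  let ?G = "density \<mu> (\<lambda>x. persp (p x) (q x)) \<bind> L"
  have Lsub: "L \<in> measurable (density \<mu> (\<lambda>x. persp (p x) (q x))) (subprob_algebra N)"
    using measurable_prob_algebraD[OF L] by simp
  have sp: "space \<nu> = space N" using sets\<nu> by (rule sets_eq_imp_space_eq)
  have setsG: "sets ?G = sets \<nu>"
    using ne sets\<nu> sets_bind[of "density \<mu> (\<lambda>x. persp (p x) (q x))" L N] subprob_measurableD(2)[OF Lsub]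
    by auto
  have "(\<integral>\<^sup>+y. persp (p' y) (q' y) \<partial>\<nu>) = emeasure (density \<nu> (\<lambda>y. persp (p' y) (q' y))) (space N)"
    using sp by (subst emeasure_density) (auto intro!: nn_integral_cong simp flip: sp)
  also have "\<dots> \<le> emeasure ?G (space N)"
    using density_persp_bind[OF assms True] setsG sets\<nu> by (subst (asm) le_measure) auto
  also have "\<dots> = (\<integral>\<^sup>+x. emeasure (L x) (space N) \<partial>density \<mu> (\<lambda>x. persp (p x) (q x)))"
    using ne by (intro emeasure_bind[OF _ Lsub]) auto
  also have "\<dots> = (\<integral>\<^sup>+x. 1 \<partial>density \<mu> (\<lambda>x. persp (p x) (q x)))"
  proof (rule nn_integral_cong)
    fix x assume "x \<in> space (density \<mu> (\<lambda>x. persp (p x) (q x)))"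
    then have "L x \<in> space (prob_algebra N)" using measurable_space[OF L] by simp
    then show "emeasure (L x) (space N) = 1"
      using prob_space.emeasure_space_1[of "L x"] sets_eq_imp_space_eq[of "L x" N]
      by (simp add: space_prob_algebra)
  qed
  also have "\<dots> = (\<integral>\<^sup>+x. persp (p x) (q x) \<partial>\<mu>)"
    by (subst nn_integral_density) auto
  finally show ?thesis .
qed (auto simp: not_less top_unique)

end

section \<open>The divergence as the integral of a perspective\<close>

lemma ereal_integral_cong_AE:
  assumes "AE x in M. g x = h x"
  shows "ereal_integral M g = ereal_integral M h"
  unfolding ereal_integral_def
  by (intro arg_cong2[where f="(-)"] arg_cong[where f=enn2ereal] nn_integral_cong_AE)
    (use assms in \<open>auto elim!: eventually_mono\<close>)

text \<open>
Additivity of the extended integral holds here although \<open>u\<close> may have infinite integral,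
because the negative part of the sum is bounded by that of \<open>h\<close>.
\<close>

lemma ereal_integral_enn2ereal_add:
  assumes [measurable]: "u \<in> borel_measurable M" and h: "integrable M h"
  shows "ereal_integral M (\<lambda>x. enn2ereal (u x) + ereal (h x)) =
    enn2ereal (\<integral>\<^sup>+x. u x \<partial>M) + ereal (\<integral>x. h x \<partial>M)"
proof -
  define v where "v x = enn2ereal (u x) + ereal (h x)" for x
  have [measurable]: "h \<in> borel_measurable M" using h by simp
  have [measurable]: "v \<in> borel_measurable M" unfolding v_def by measurable
  define pos where "pos = (\<integral>\<^sup>+x. e2ennreal (v x) \<partial>M)"
  define neg where "neg = (\<integral>\<^sup>+x. e2ennreal (- v x) \<partial>M)"
  define U where "U = (\<integral>\<^sup>+x. u x \<partial>M)"
  define hp where "hp = (\<integral>\<^sup>+x. ennreal (h x) \<partial>M)"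
  define hn where "hn = (\<integral>\<^sup>+x. ennreal (- h x) \<partial>M)"
  \<comment> \<open>Rearranged so that only sums of nonnegative terms occur, which may be integrated separately.\<close>
  have pt: "e2ennreal (v x) + ennreal (- h x) = u x + ennreal (h x) + e2ennreal (- v x)"
      "e2ennreal (- v x) \<le> ennreal (- h x)" for x
  proof -
    have "e2ennreal (v x) + ennreal (- h x) = u x + ennreal (h x) + e2ennreal (- v x) \<and>
        e2ennreal (- v x) \<le> ennreal (- h x)"
    proof (cases "u x")
      case (real r)
      then have "v x = ereal (r + h x)" by (simp add: v_def)
      with real show ?thesis
        by (cases "0 \<le> h x"; cases "0 \<le> r + h x")
          (auto simp: e2ennreal_ereal ennreal_neg ennreal_leI simp flip: ennreal_plus)
    next
      case top
      then have "v x = \<infinity>" by (simp add: v_def)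
      with top show ?thesis by (simp add: e2ennreal_infty e2ennreal_neg)
    qed
    then show "e2ennreal (v x) + ennreal (- h x) = u x + ennreal (h x) + e2ennreal (- v x)"
      "e2ennreal (- v x) \<le> ennreal (- h x)" by auto
  qed
  have "pos + hn = (\<integral>\<^sup>+x. e2ennreal (v x) + ennreal (- h x) \<partial>M)"
    unfolding pos_def hn_def by (subst nn_integral_add) auto
  also have "\<dots> = U + hp + neg"
    unfolding pt U_def hp_def neg_def by (simp add: nn_integral_add)
  finally have sum: "pos + hn = U + hp + neg" .
  have neg_le: "neg \<le> hn"
    unfolding neg_def hn_def by (intro nn_integral_mono pt)
  have fin: "hp \<noteq> \<infinity>" "hn \<noteq> \<infinity>"
    using h unfolding hp_def hn_def real_integrable_def by auto
  have int_h: "(\<integral>x. h x \<partial>M) = enn2real hp - enn2real hn"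
    unfolding hp_def hn_def using h by (rule real_lebesgue_integral_def)
  have "enn2ereal pos - enn2ereal neg = enn2ereal U + ereal (enn2real hp - enn2real hn)"
    using sum neg_le fin
    by (cases pos; cases neg; cases U; cases hp; cases hn)
      (auto simp: top_unique simp flip: ennreal_plus)
  then show ?thesis
    by (simp add: ereal_integral_def v_def[symmetric] pos_def neg_def U_def int_h)
qed

lemma less_e2ennreal_diff:
  assumes "y < e2ennreal (z - ereal r)"
  obtains s where "y = ennreal s" "s \<ge> 0" "ereal (s + r) < z"
proof -
  from assms obtain s where s: "y = ennreal s" "s \<ge> 0"
    by (cases y) auto
  have "ereal s < z - ereal r"
  proof (rule ccontr)
    assume "\<not> ereal s < z - ereal r"
    then have "e2ennreal (z - ereal r) \<le> e2ennreal (ereal s)"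
      by (intro e2ennreal_mono) simp
    with assms s show False by (simp add: e2ennreal_ereal)
  qed
  then have "ereal (s + r) < z"
    by (cases z) auto
  with s show ?thesis by (rule that)
qed

text \<open>
Subtracting from \<open>f\<close> its tangent \<open>c * (t - 1)\<close> at \<open>1\<close> makes it nonnegative and does not change the
divergence of two probability measures: the tangent contributes \<open>c\<close> times the difference of their
masses. All integrals can then be taken in \<^typ>\<open>ennreal\<close>.
\<close>

context
  fixes f :: "real \<Rightarrow> ereal" and c :: real
  assumes f: "f \<in> csiszar_functions" and c: "(c, - c) \<in> affine_minorants f"
begin

definition tilted :: "real \<Rightarrow> ennreal" where
  "tilted t = e2ennreal (f t - ereal (c * (t - 1)))"

definition tilted_slope :: ennreal where
  "tilted_slope = e2ennreal (adjoint_at_0 f - ereal c)"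

lemma eq_tilted_add_tangent: "f t = enn2ereal (tilted t) + ereal (c * (t - 1))"
proof -
  have "ereal (c * t + - c) \<le> f t"
    using c unfolding affine_minorants_def by blast
  then have "0 \<le> f t - ereal (c * (t - 1))"
    by (cases "f t") (auto simp: algebra_simps)
  then show ?thesis
    unfolding tilted_def by (cases "f t") (auto simp: enn2ereal_e2ennreal)
qed

lemma adjoint_eq_tilted_slope_add: "adjoint_at_0 f = enn2ereal tilted_slope + ereal c"
proof -
  have "0 \<le> adjoint_at_0 f - ereal c"
    using slope_le_adjoint[OF f c] by (cases "adjoint_at_0 f") auto
  then show ?thesis
    unfolding tilted_slope_def by (cases "adjoint_at_0 f") (auto simp: enn2ereal_e2ennreal)
qed

lemma supported_function_tilted:
  "supported_function tilted tilted_slope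
     ((\<lambda>(a, b). (a - c, b + c)) ` (affine_minorants f \<inter> \<rat> \<times> \<rat>)) (frontier (eff_dom f))"
proof
  show "countable ((\<lambda>(a, b). (a - c, b + c)) ` (affine_minorants f \<inter> \<rat> \<times> \<rat>))"
    by (intro countable_image countable_Int2 countable_SIGMA countable_rat)
  show "countable (frontier (eff_dom f))"
    by (rule countable_frontier_eff_dom[OF f])
next
  fix a b t :: real
  assume "(a, b) \<in> (\<lambda>(a, b). (a - c, b + c)) ` (affine_minorants f \<inter> \<rat> \<times> \<rat>)"
  then have ab: "(a + c, b - c) \<in> affine_minorants f"
    by auto
  have "ereal ((a + c) * t + (b - c)) \<le> f t"
    using ab unfolding affine_minorants_def by blast
  then have "ereal (a * t + b) \<le> f t - ereal (c * (t - 1))"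
    by (cases "f t") (auto simp: algebra_simps)
  from e2ennreal_mono[OF this] show "ennreal (a * t + b) \<le> tilted t"
    by (simp add: tilted_def)
  have "ereal a \<le> adjoint_at_0 f - ereal c"
    using slope_le_adjoint[OF f ab] by (cases "adjoint_at_0 f") auto
  from e2ennreal_mono[OF this] show "ennreal a \<le> tilted_slope"
    by (simp add: tilted_slope_def)
next
  fix t :: real assume t: "0 \<le> t" "t \<notin> frontier (eff_dom f)"
  show "tilted t \<le> (SUP (a, b)\<in>(\<lambda>(a, b). (a - c, b + c)) ` (affine_minorants f \<inter> \<rat> \<times> \<rat>). ennreal (a * t + b))"
    unfolding le_SUP_iff
  proof (intro allI impI)
    fix y assume "y < tilted t"
    then obtain s where s: "y = ennreal s" "s \<ge> 0" "ereal (s + c * (t - 1)) < f t"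
      unfolding tilted_def by (rule less_e2ennreal_diff)
    from ex_rational_minorant_above[OF f t s(3)] obtain a b
      where ab: "(a, b) \<in> affine_minorants f \<inter> \<rat> \<times> \<rat>" "s + c * (t - 1) < a * t + b"
      by auto
    then have "y < ennreal ((a - c) * t + (b + c))"
      using s(1,2) by (auto simp: algebra_simps ennreal_less_iff)
    with ab(1) show "\<exists>i\<in>(\<lambda>(a, b). (a - c, b + c)) ` (affine_minorants f \<inter> \<rat> \<times> \<rat>).
        y < (case i of (a, b) \<Rightarrow> ennreal (a * t + b))"
      by (intro bexI[of _ "(a - c, b + c)"]) auto
  qed
next
  show "tilted_slope \<le> (SUP (a, b)\<in>(\<lambda>(a, b). (a - c, b + c)) ` (affine_minorants f \<inter> \<rat> \<times> \<rat>). ennreal a)"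
    unfolding le_SUP_iff
  proof (intro allI impI)
    fix y assume "y < tilted_slope"
    then obtain s where s: "y = ennreal s" "s \<ge> 0" "ereal (s + c) < adjoint_at_0 f"
      unfolding tilted_slope_def by (rule less_e2ennreal_diff)
    from ex_rational_slope_above[OF f s(3)] obtain a b
      where ab: "(a, b) \<in> affine_minorants f \<inter> \<rat> \<times> \<rat>" "s + c < a"
      by auto
    then have "y < ennreal (a - c)"
      using s(1,2) by (auto simp: ennreal_less_iff)
    with ab(1) show "\<exists>i\<in>(\<lambda>(a, b). (a - c, b + c)) ` (affine_minorants f \<inter> \<rat> \<times> \<rat>).
        y < (case i of (a, b) \<Rightarrow> ennreal a)"
      by (intro bexI[of _ "(a - c, b + c)"]) auto
  qed
next
  fix e assume "e \<in> frontier (eff_dom f)"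
  from frontier_eff_dom_cases[OF f this]
  show "(\<forall>t>e. tilted t = \<infinity>) \<and> tilted_slope = \<infinity> \<or> (\<forall>t. 0 \<le> t \<and> t < e \<longrightarrow> tilted t = \<infinity>)"
    by (auto simp: tilted_def tilted_slope_def)
qed

text \<open>
Let \<open>m\<close> be the mass of the part of \<open>P\<close> that is singular to \<open>Q\<close>. The tangent contributes
\<open>c * (1 - m - 1)\<close> to the integral and, since \<open>adjoint_at_0 f\<close> exceeds \<open>tilted_slope\<close> by \<open>c\<close>, it
contributes \<open>c * m\<close> to the singular term.
\<close>

lemma f_divergence_eq_perspective:
  fixes p q :: "'a \<Rightarrow> real"
  assumes prob: "prob_space P" "prob_space Q" and \<mu>: "sigma_finite_measure \<mu>"
    and [measurable]: "p \<in> borel_measurable \<mu>" "q \<in> borel_measurable \<mu>"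
    and nonneg: "\<And>x. p x \<ge> 0" "\<And>x. q x \<ge> 0"
    and P: "density \<mu> p = P" and Q: "density \<mu> q = Q"
  shows "f_divergence f P Q = enn2ereal (\<integral>\<^sup>+x. perspective tilted tilted_slope (p x) (q x) \<partial>\<mu>)"
proof -
  interpret P: prob_space P by fact
  interpret Q: prob_space Q by fact
  interpret supported_function tilted tilted_slope
    "(\<lambda>(a, b). (a - c, b + c)) ` (affine_minorants f \<inter> \<rat> \<times> \<rat>)" "frontier (eff_dom f)"
    by (rule supported_function_tilted)
  have sets_P [measurable_cong]: "sets P = sets \<mu>" and sets_Q [measurable_cong]: "sets Q = sets \<mu>"
    using P Q by auto
  have sp_P [simp]: "space P = space \<mu>"
    using P by auto
  define m where "m = measure P {x \<in> space \<mu>. q x = 0}"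
  have "0 \<le> m"
    by (simp add: m_def)
  have AE_q: "AE x in Q. q x > 0"
    unfolding Q[symmetric] by (subst AE_density) (use nonneg in auto)
  have AE_p: "AE x in P. p x > 0"
    unfolding P[symmetric] by (subst AE_density) (use nonneg in auto)
  have [measurable]: "(\<lambda>x. tilted (p x / q x)) \<in> borel_measurable \<mu>"
    using measurable_persp[of "\<lambda>x. p x / q x" \<mu> "\<lambda>_. 1"] nonneg by (simp add: perspective_def)
  have p_on: "integrable \<mu> (\<lambda>x. p x * indicator A x)" "(\<integral>x. p x * indicator A x \<partial>\<mu>) = measure P A"
    if [measurable]: "A \<in> sets \<mu>" for A
  proof -
    have em: "(\<integral>\<^sup>+x. ennreal (p x * indicator A x) \<partial>\<mu>) = emeasure P A"
      unfolding P[symmetric] using nonneg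
      by (subst emeasure_density) (auto intro!: nn_integral_cong simp: indicator_def)
    then show "integrable \<mu> (\<lambda>x. p x * indicator A x)"
      using nonneg by (intro integrableI_nonneg) (auto simp: less_top[symmetric])
    show "(\<integral>x. p x * indicator A x \<partial>\<mu>) = measure P A"
      using nonneg em by (subst integral_eq_nn_integral) (auto simp: measure_def)
  qed
  have ratio: "integrable Q (\<lambda>x. p x / q x)" "(\<integral>x. p x / q x \<partial>Q) = 1 - m"
  proof -
    have eq: "q x *\<^sub>R (p x / q x) = p x * indicator {x \<in> space \<mu>. q x \<noteq> 0} x" if "x \<in> space \<mu>" for x
      using that by (auto simp: indicator_def)
    have "integrable Q (\<lambda>x. p x / q x) \<longleftrightarrow> integrable \<mu> (\<lambda>x. q x *\<^sub>R (p x / q x))"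
      unfolding Q[symmetric] using nonneg by (intro integrable_density) auto
    also have "\<dots> \<longleftrightarrow> integrable \<mu> (\<lambda>x. p x * indicator {x \<in> space \<mu>. q x \<noteq> 0} x)"
      by (intro Bochner_Integration.integrable_cong refl eq)
    finally show "integrable Q (\<lambda>x. p x / q x)"
      using p_on(1)[of "{x \<in> space \<mu>. q x \<noteq> 0}"] by simp
    have "(\<integral>x. p x / q x \<partial>Q) = (\<integral>x. q x *\<^sub>R (p x / q x) \<partial>\<mu>)"
      unfolding Q[symmetric] using nonneg by (intro integral_density) auto
    also have "\<dots> = (\<integral>x. p x * indicator {x \<in> space \<mu>. q x \<noteq> 0} x \<partial>\<mu>)"
      by (intro Bochner_Integration.integral_cong refl eq)
    also have "\<dots> = measure P {x \<in> space P. \<not> q x = 0}"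
      by (subst p_on) auto
    also have "\<dots> = 1 - m"
      unfolding m_def by (subst P.prob_neg) auto
    finally show "(\<integral>x. p x / q x \<partial>Q) = 1 - m" .
  qed
  have "ereal_integral Q (\<lambda>x. f (enn2real (ennreal (p x) / ennreal (q x)))) =
      ereal_integral Q (\<lambda>x. enn2ereal (tilted (p x / q x)) + ereal (c * (p x / q x - 1)))"
  proof (rule ereal_integral_cong_AE, use AE_q in eventually_elim)
    case (elim x)
    then show ?case
      using nonneg by (simp add: divide_ennreal flip: eq_tilted_add_tangent)
  qed
  also have "\<dots> = enn2ereal (\<integral>\<^sup>+x. tilted (p x / q x) \<partial>Q) + ereal (\<integral>x. c * (p x / q x - 1) \<partial>Q)"
    using ratio(1) by (intro ereal_integral_enn2ereal_add) auto
  also have "(\<integral>x. c * (p x / q x - 1) \<partial>Q) = - (c * m)"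
    using ratio by (simp add: Q.prob_space)
  also have "(\<integral>\<^sup>+x. tilted (p x / q x) \<partial>Q) = (\<integral>\<^sup>+x. ennreal (q x) * tilted (p x / q x) \<partial>\<mu>)"
    unfolding Q[symmetric] by (subst nn_integral_density) auto
  finally have regular: "ereal_integral Q (\<lambda>x. f (enn2real (ennreal (p x) / ennreal (q x)))) =
      enn2ereal (\<integral>\<^sup>+x. ennreal (q x) * tilted (p x / q x) \<partial>\<mu>) + ereal (- (c * m))" .
  have "measure P {x \<in> space P. ennreal (p x) / ennreal (q x) = \<infinity>} = m"
    unfolding m_def
  proof (rule measure_eq_AE)
    show "AE x in P. x \<in> {x \<in> space P. ennreal (p x) / ennreal (q x) = \<infinity>} \<longleftrightarrow>
        x \<in> {x \<in> space \<mu>. q x = 0}"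
      using AE_p
    proof eventually_elim
      case (elim x)
      then show ?case
        using nonneg(2)[of x] by (cases "q x = 0") (auto simp: divide_ennreal)
    qed
  qed auto
  moreover have "adjoint_at_0 f * ereal m = enn2ereal (tilted_slope * ennreal m) + ereal (c * m)"
  proof (cases tilted_slope)
    case (real r)
    then have "adjoint_at_0 f * ereal m = ereal (r * m + c * m)"
      by (simp add: adjoint_eq_tilted_slope_add distrib_right)
    moreover have "tilted_slope * ennreal m = ennreal (r * m)"
      using real by (simp add: ennreal_mult')
    ultimately show ?thesis
      using real(1) \<open>0 \<le> m\<close> by simp
  next
    case top
    show ?thesis
    proof (cases "m = 0")
      case True
      then show ?thesis by (simp add: zero_ennreal.rep_eq)
    next
      case False
      then have "m > 0" using \<open>0 \<le> m\<close> by simp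
      then show ?thesis
        using top by (simp add: adjoint_eq_tilted_slope_add ennreal_top_mult)
    qed
  qed
  ultimately have singular: "adjoint_at_0 f * ereal (measure P {x \<in> space P. ennreal (p x) / ennreal (q x) = \<infinity>}) =
      enn2ereal (tilted_slope * ennreal m) + ereal (c * m)"
    by simp
  have "(\<integral>\<^sup>+x. perspective tilted tilted_slope (p x) (q x) \<partial>\<mu>) =
      (\<integral>\<^sup>+x. ennreal (q x) * tilted (p x / q x) +
        tilted_slope * (ennreal (p x) * indicator {x \<in> space \<mu>. q x = 0} x) \<partial>\<mu>)"
    by (intro nn_integral_cong) (auto simp: perspective_def indicator_def)
  also have "\<dots> = (\<integral>\<^sup>+x. ennreal (q x) * tilted (p x / q x) \<partial>\<mu>) +
      tilted_slope * (\<integral>\<^sup>+x. ennreal (p x) * indicator {x \<in> space \<mu>. q x = 0} x \<partial>\<mu>)"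
    by (subst nn_integral_add) (auto simp: nn_integral_cmult)
  also have "(\<integral>\<^sup>+x. ennreal (p x) * indicator {x \<in> space \<mu>. q x = 0} x \<partial>\<mu>) = ennreal m"
    unfolding m_def P.emeasure_eq_measure[symmetric] unfolding P[symmetric]
    by (subst emeasure_density) auto
  finally have split: "(\<integral>\<^sup>+x. perspective tilted tilted_slope (p x) (q x) \<partial>\<mu>) =
      (\<integral>\<^sup>+x. ennreal (q x) * tilted (p x / q x) \<partial>\<mu>) + tilted_slope * ennreal m" .
  have "f_divergence f P Q = f_divergence_ratio f (\<lambda>x. ennreal (p x) / ennreal (q x)) P Q"
    by (rule f_divergence_eq[OF _ _ \<mu> _ _ P Q]) (auto intro: P.finite_measure_axioms Q.finite_measure_axioms)
  also have "\<dots> = enn2ereal ((\<integral>\<^sup>+x. ennreal (q x) * tilted (p x / q x) \<partial>\<mu>) + tilted_slope * ennreal m)"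
    unfolding f_divergence_ratio_def regular singular
    by (cases "\<integral>\<^sup>+x. ennreal (q x) * tilted (p x / q x) \<partial>\<mu>"; cases "tilted_slope * ennreal m")
      (auto simp flip: ennreal_plus)
  finally show ?thesis
    unfolding split .
qed

end

lemma ex_real_densities:
  assumes "finite_measure P" "finite_measure Q" "sets P = sets Q"
  obtains \<mu> and p q :: "'a \<Rightarrow> real" where "finite_measure \<mu>" "sets \<mu> = sets P"
    "p \<in> borel_measurable \<mu>" "q \<in> borel_measurable \<mu>" "\<And>x. p x \<ge> 0" "\<And>x. q x \<ge> 0"
    "density \<mu> p = P" "density \<mu> q = Q"
proof -
  interpret P: finite_measure P by fact
  interpret Q: finite_measure Q by fact
  define \<mu> where "\<mu> = add_measures P Q"
  have sets\<mu>: "sets \<mu> = sets P"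
    by (simp add: \<mu>_def)
  have em: "emeasure \<mu> A = emeasure P A + emeasure Q A" if "A \<in> sets P" for A
    unfolding \<mu>_def by (rule emeasure_add_measures[OF assms(3) that])
  interpret \<mu>: finite_measure \<mu>
    by (rule finite_measureI) (simp add: \<mu>_def em[unfolded \<mu>_def] P.emeasure_finite Q.emeasure_finite)
  have dens: "\<exists>d::'a \<Rightarrow> real. d \<in> borel_measurable \<mu> \<and> (\<forall>x. 0 \<le> d x) \<and> density \<mu> (\<lambda>x. ennreal (d x)) = R"
    if fin: "finite_measure R" and setsR: "sets R = sets \<mu>" and ac: "absolutely_continuous \<mu> R" for R
  proof -
    obtain D where D: "D \<in> borel_measurable \<mu>" "AE x in \<mu>. RN_deriv \<mu> R x = ennreal (D x)" "\<And>x. 0 \<le> D x"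
      using \<mu>.real_RN_deriv[OF fin ac setsR] by metis
    have "density \<mu> D = density \<mu> (RN_deriv \<mu> R)"
      using D by (intro density_cong) (auto elim!: eventually_mono)
    also have "\<dots> = R"
      by (rule \<mu>.density_RN_deriv[OF ac setsR])
    finally show ?thesis
      using D(1,3) by blast
  qed
  have "absolutely_continuous \<mu> P" "absolutely_continuous \<mu> Q"
    unfolding absolutely_continuous_def null_sets_def using em sets\<mu> assms(3) by auto
  then obtain p q :: "'a \<Rightarrow> real" where
    "p \<in> borel_measurable \<mu>" "\<forall>x. 0 \<le> p x" "density \<mu> p = P"
    "q \<in> borel_measurable \<mu>" "\<forall>x. 0 \<le> q x" "density \<mu> q = Q"
    using dens[of P] dens[of Q] assms sets\<mu> by auto
  then show ?thesis
    by (intro that[of \<mu> p q] \<mu>.finite_measure_axioms sets\<mu>) auto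
qed

text \<open>
The source and the target each have a finite dominating measure, the sum of the two
given measures. Both divergences are then integrals of the perspective of the same function,
because a Markov kernel preserves the total mass on which the subtraction of the tangent depends.
\<close>

theorem f_divergence_bind_le:
  assumes f: "f \<in> csiszar_functions"
    and P: "P \<in> space (prob_algebra M)" and Q: "Q \<in> space (prob_algebra M)"
    and L: "L \<in> measurable M (prob_algebra N)"
  shows "f_divergence f (P \<bind> L) (Q \<bind> L) \<le> f_divergence f P Q"
proof -
  obtain a b where ab: "(a, b) \<in> affine_minorants f" "ereal (a * 1 + b) = f 1"
    using ex_tangent[OF f one_in_interior[OF f]] by auto
  then have c: "(a, - a) \<in> affine_minorants f"
    using at_one[OF f] by (simp add: zero_ereal_def add_eq_0_iff)
  interpret supported_function "tilted f a" "tilted_slope f a"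
    "(\<lambda>(a', b'). (a' - a, b' + a)) ` (affine_minorants f \<inter> \<rat> \<times> \<rat>)" "frontier (eff_dom f)"
    by (rule supported_function_tilted[OF f c])
  have prob: "prob_space P" "prob_space Q" and sets: "sets P = sets M" "sets Q = sets M"
    using P Q by (auto simp: space_prob_algebra)
  have prob': "prob_space (P \<bind> L)" "prob_space (Q \<bind> L)"
    and sets': "sets (P \<bind> L) = sets N" "sets (Q \<bind> L) = sets N"
    using P Q L by (auto intro: prob_space_bind' simp: sets_bind')
  obtain \<mu> and p q :: "'a \<Rightarrow> real" where \<mu>: "finite_measure \<mu>" "sets \<mu> = sets P"
    "p \<in> borel_measurable \<mu>" "q \<in> borel_measurable \<mu>" "\<And>x. p x \<ge> 0" "\<And>x. q x \<ge> 0"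
    "density \<mu> p = P" "density \<mu> q = Q"
    using ex_real_densities[of P Q] prob sets by (metis prob_space_def)
  obtain \<nu> and p' q' :: "'b \<Rightarrow> real" where \<nu>: "finite_measure \<nu>" "sets \<nu> = sets (P \<bind> L)"
    "p' \<in> borel_measurable \<nu>" "q' \<in> borel_measurable \<nu>" "\<And>x. p' x \<ge> 0" "\<And>x. q' x \<ge> 0"
    "density \<nu> p' = P \<bind> L" "density \<nu> q' = Q \<bind> L"
    using ex_real_densities[of "P \<bind> L" "Q \<bind> L"] prob' sets' by (metis prob_space_def)
  have sf: "sigma_finite_measure \<mu>" "sigma_finite_measure \<nu>"
    using \<mu>(1) \<nu>(1) by (simp_all add: finite_measure_def)
  have "space \<mu> \<noteq> {}"
    using prob_space.not_empty[OF prob(1)] \<mu>(7) by auto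
  then have "(\<integral>\<^sup>+y. persp (p' y) (q' y) \<partial>\<nu>) \<le> (\<integral>\<^sup>+x. persp (p x) (q x) \<partial>\<mu>)"
    using \<mu> \<nu> sets sets' L prob
    by (intro nn_integral_persp_bind_le[where L=L and N=N])
      (auto simp: prob_space_def cong: measurable_cong_sets)
  then show ?thesis
    using f_divergence_eq_perspective[OF f c prob sf(1) \<mu>(3-8)]
      f_divergence_eq_perspective[OF f c prob' sf(2) \<nu>(3-8)]
    by (simp add: less_eq_ennreal.rep_eq)
qed

section \<open>Resampling from a conditional distribution\<close>

lemma measure_eqI_rectangles:
  assumes sets: "sets P = sets (M \<Otimes>\<^sub>M N)" "sets Q = sets (M \<Otimes>\<^sub>M N)" and "finite_measure P"
    and eq: "\<And>A B. A \<in> sets M \<Longrightarrow> B \<in> sets N \<Longrightarrow> emeasure P (A \<times> B) = emeasure Q (A \<times> B)"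
  shows "P = Q"
proof (rule measure_eqI_generator_eq[OF Int_stable_pair_measure_generator[of M N]])
  interpret finite_measure P by fact
  show "{A \<times> B |A B. A \<in> sets M \<and> B \<in> sets N} \<subseteq> Pow (space M \<times> space N)"
    using sets.space_closed[of M] sets.space_closed[of N] by auto
  show "sets P = sigma_sets (space M \<times> space N) {A \<times> B |A B. A \<in> sets M \<and> B \<in> sets N}"
    "sets Q = sigma_sets (space M \<times> space N) {A \<times> B |A B. A \<in> sets M \<and> B \<in> sets N}"
    using sets by (simp_all add: sets_pair_measure)
  show "range (\<lambda>_::nat. space M \<times> space N) \<subseteq> {A \<times> B |A B. A \<in> sets M \<and> B \<in> sets N}"
    by auto
  show "emeasure P (space M \<times> space N) \<noteq> \<infinity>"
    by simp
qed (use eq in auto)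

context
  fixes M :: "'w measure" and MX :: "'a measure" and MY :: "'b measure" and MZ :: "'c measure"
    and X :: "'w \<Rightarrow> 'a" and Y :: "'w \<Rightarrow> 'b" and Z :: "'w \<Rightarrow> 'c" and K :: "'b \<Rightarrow> 'c measure"
  assumes M: "prob_space M"
    and X [measurable]: "X \<in> measurable M MX" and Y [measurable]: "Y \<in> measurable M MY"
    and Z [measurable]: "Z \<in> measurable M MZ"
    and K: "cond_distribution M MY MZ Y Z K"
begin

interpretation prob_space M by (rule M)

lemma measurable_K [measurable]: "K \<in> measurable MY (prob_algebra MZ)"
  using K by (simp add: cond_distribution_def)

lemma prob_K: "y \<in> space MY \<Longrightarrow> prob_space (K y) \<and> sets (K y) = sets MZ"
  using measurable_space[OF measurable_K] by (simp add: space_prob_algebra)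

lemma emeasure_K: "y \<in> space MY \<Longrightarrow> emeasure (K y) C = ennreal (measure (K y) C)"
  using prob_K by (simp add: finite_measure.emeasure_eq_measure prob_space.finite_measure)

lemma measurable_measure_K [measurable]:
  "C \<in> sets MZ \<Longrightarrow> (\<lambda>y. measure (K y) C) \<in> borel_measurable MY"
  by (rule measurable_compose[OF measurable_K measurable_measure_prob_algebra])

lemma emeasure_Y_Z:
  assumes [measurable]: "B \<in> sets MY" "C \<in> sets MZ"
  shows "emeasure M {\<omega> \<in> space M. Y \<omega> \<in> B \<and> Z \<omega> \<in> C} =
    (\<integral>\<^sup>+\<omega>. indicator B (Y \<omega>) * ennreal (measure (K (Y \<omega>)) C) \<partial>M)"
proof -
  have "emeasure M {\<omega> \<in> space M. Y \<omega> \<in> B \<and> Z \<omega> \<in> C} =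
      emeasure (distr M (MY \<Otimes>\<^sub>M MZ) (\<lambda>\<omega>. (Y \<omega>, Z \<omega>))) (B \<times> C)"
    by (subst emeasure_distr) (auto intro!: arg_cong[where f="emeasure M"])
  also have "\<dots> = (\<integral>\<^sup>+y. \<integral>\<^sup>+z. indicator (B \<times> C) (y, z) \<partial>K y \<partial>distr M MY Y)"
    using K pair_measureI[OF assms] unfolding cond_distribution_def by blast
  also have "\<dots> = (\<integral>\<^sup>+y. indicator B y * ennreal (measure (K y) C) \<partial>distr M MY Y)"
  proof (intro nn_integral_cong)
    fix y assume "y \<in> space (distr M MY Y)"
    then have y: "y \<in> space MY" by simp
    then have "C \<in> sets (K y)" using prob_K by simp
    then show "(\<integral>\<^sup>+z. indicator (B \<times> C) (y, z) \<partial>K y) = indicator B y * ennreal (measure (K y) C)"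
      by (simp add: indicator_times nn_integral_cmult emeasure_K[OF y])
  qed
  also have "\<dots> = (\<integral>\<^sup>+\<omega>. indicator B (Y \<omega>) * ennreal (measure (K (Y \<omega>)) C) \<partial>M)"
    by (subst nn_integral_distr) auto
  finally show ?thesis .
qed

lemma emeasure_Z:
  assumes C [measurable]: "C \<in> sets MZ"
  shows "emeasure M {\<omega> \<in> space M. Z \<omega> \<in> C} = (\<integral>\<^sup>+\<omega>. ennreal (measure (K (Y \<omega>)) C) \<partial>M)"
proof -
  have "{\<omega> \<in> space M. Y \<omega> \<in> space MY \<and> Z \<omega> \<in> C} = {\<omega> \<in> space M. Z \<omega> \<in> C}"
    using measurable_space[OF Y] by auto
  moreover have "(\<integral>\<^sup>+\<omega>. indicator (space MY) (Y \<omega>) * ennreal (measure (K (Y \<omega>)) C) \<partial>M) =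
      (\<integral>\<^sup>+\<omega>. ennreal (measure (K (Y \<omega>)) C) \<partial>M)"
    using measurable_space[OF Y] by (intro nn_integral_cong) simp
  ultimately show ?thesis
    using emeasure_Y_Z[OF sets.top C] by simp
qed

text \<open>
Conditional independence in terms of the kernel: given \<open>Y\<close>, the conditional probability of \<open>Z\<close> being in
\<open>C\<close> is \<open>measure (K (Y \<omega>)) C\<close> by uniqueness of conditional expectations, and it may be
integrated against the indicator of \<open>X \<in> A\<close> instead of against its conditional
expectation.
\<close>

lemma emeasure_X_Z:
  assumes ci: "cond_indep M MX MY MZ X Y Z"
    and A [measurable]: "A \<in> sets MX" and C [measurable]: "C \<in> sets MZ"
  shows "emeasure M {\<omega> \<in> space M. X \<omega> \<in> A \<and> Z \<omega> \<in> C} =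
    (\<integral>\<^sup>+\<omega>. indicator A (X \<omega>) * ennreal (measure (K (Y \<omega>)) C) \<partial>M)"
proof -
  define F where "F = vimage_algebra (space M) Y MY"
  have sets_F: "sets F = {Y -` B \<inter> space M |B. B \<in> sets MY}"
    unfolding F_def using measurable_space[OF Y] by (intro sets_vimage_algebra2) auto
  have subF: "subalgebra M F"
    unfolding subalgebra_def sets_F using measurable_sets[OF Y] by (auto simp: F_def)
  interpret finite_measure_subalgebra M F
    by unfold_locales (rule subF)
  define k where "k \<omega> = measure (K (Y \<omega>)) C" for \<omega>
  have "Y \<in> measurable F MY"
    unfolding F_def using measurable_space[OF Y] by (intro measurable_vimage_algebra1) auto
  then have kF [measurable]: "k \<in> borel_measurable F"
    unfolding k_def by measurable
  have k_M [measurable]: "k \<in> borel_measurable M"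
    unfolding k_def by measurable
  have k01: "0 \<le> k \<omega>" "\<omega> \<in> space M \<Longrightarrow> k \<omega> \<le> 1" for \<omega>
    unfolding k_def using prob_space.prob_le_1[of "K (Y \<omega>)"] prob_K measurable_space[OF Y] by auto
  have integrable: "integrable M (\<lambda>\<omega>. u \<omega> * k \<omega>)"
    if [measurable]: "u \<in> borel_measurable M" and u: "\<And>\<omega>. 0 \<le> u \<omega> \<and> u \<omega> \<le> 1" for u :: "'w \<Rightarrow> real"
    using k01 u by (intro integrable_const_bound[of _ 1]) (auto simp: abs_mult intro!: mult_le_one)
  have k_cond: "AE \<omega> in M. real_cond_exp M F (\<lambda>\<omega>. indicator C (Z \<omega>)) \<omega> = k \<omega>"
  proof (rule real_cond_exp_charact)
    fix S assume "S \<in> sets F"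
    then obtain B where B [measurable]: "B \<in> sets MY" and S: "S = Y -` B \<inter> space M"
      unfolding sets_F by auto
    have "(\<integral>\<omega>\<in>S. indicator C (Z \<omega>) \<partial>M) = (\<integral>\<omega>. indicator {\<omega> \<in> space M. Y \<omega> \<in> B \<and> Z \<omega> \<in> C} \<omega> \<partial>M)"
      unfolding set_lebesgue_integral_def S by (intro Bochner_Integration.integral_cong) (auto simp: indicator_def)
    also have "\<dots> = measure M {\<omega> \<in> space M. Y \<omega> \<in> B \<and> Z \<omega> \<in> C}"
      by simp
    also have "\<dots> = enn2real (\<integral>\<^sup>+\<omega>. ennreal (indicator B (Y \<omega>) * k \<omega>) \<partial>M)"
      unfolding measure_def emeasure_Y_Z[OF B C] k_def
      by (simp add: ennreal_mult'' ennreal_indicator)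
    also have "\<dots> = (\<integral>\<omega>. indicator B (Y \<omega>) * k \<omega> \<partial>M)"
      using k01 by (subst integral_eq_nn_integral) auto
    also have "\<dots> = (\<integral>\<omega>\<in>S. k \<omega> \<partial>M)"
      unfolding set_lebesgue_integral_def S by (intro Bochner_Integration.integral_cong) (auto simp: indicator_def)
    finally show "(\<integral>\<omega>\<in>S. indicator C (Z \<omega>) \<partial>M) = (\<integral>\<omega>\<in>S. k \<omega> \<partial>M)" .
  next
    show "integrable M (\<lambda>\<omega>. indicator C (Z \<omega>) :: real)"
      by (intro integrable_const_bound[of _ 1]) (auto simp: indicator_def)
    show "integrable M k"
      using integrable[of "\<lambda>_. 1"] by simp
  qed (rule kF)
  have ind_int: "integrable M (\<lambda>\<omega>. indicator A (X \<omega>) * indicator C (Z \<omega>) :: real)"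
    by (intro integrable_const_bound[of _ 1]) (auto simp: indicator_def)
  have "measure M {\<omega> \<in> space M. X \<omega> \<in> A \<and> Z \<omega> \<in> C} =
      (\<integral>\<omega>. indicator {\<omega> \<in> space M. X \<omega> \<in> A \<and> Z \<omega> \<in> C} \<omega> \<partial>M)"
    by simp
  also have "\<dots> = (\<integral>\<omega>. indicator A (X \<omega>) * indicator C (Z \<omega>) \<partial>M)"
    by (intro Bochner_Integration.integral_cong) (auto simp: indicator_def)
  also have "\<dots> = (\<integral>\<omega>. real_cond_exp M F (\<lambda>\<omega>. indicator A (X \<omega>) * indicator C (Z \<omega>)) \<omega> \<partial>M)"
    using real_cond_exp_int(2)[OF ind_int] by simp
  also have "\<dots> = (\<integral>\<omega>. k \<omega> * real_cond_exp M F (\<lambda>\<omega>. indicator A (X \<omega>)) \<omega> \<partial>M)"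
  proof (rule integral_cong_AE)
    have "AE \<omega> in M. real_cond_exp M F (\<lambda>\<omega>. indicator A (X \<omega>) * indicator C (Z \<omega>)) \<omega> =
        real_cond_exp M F (\<lambda>\<omega>. indicator A (X \<omega>)) \<omega> * real_cond_exp M F (\<lambda>\<omega>. indicator C (Z \<omega>)) \<omega>"
      using ci A C unfolding cond_indep_def Let_def F_def by blast
    with k_cond show "AE \<omega> in M. real_cond_exp M F (\<lambda>\<omega>. indicator A (X \<omega>) * indicator C (Z \<omega>)) \<omega> =
        k \<omega> * real_cond_exp M F (\<lambda>\<omega>. indicator A (X \<omega>)) \<omega>"
      by eventually_elim simp
  qed (auto simp: k_M)
  also have "\<dots> = (\<integral>\<omega>. k \<omega> * indicator A (X \<omega>) \<partial>M)"
    using integrable[of "\<lambda>\<omega>. indicator A (X \<omega>)"]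
    by (intro real_cond_exp_intg) (auto simp: mult.commute)
  also have "\<dots> = enn2real (\<integral>\<^sup>+\<omega>. ennreal (k \<omega> * indicator A (X \<omega>)) \<partial>M)"
    using k01 by (intro integral_eq_nn_integral) auto
  finally have "measure M {\<omega> \<in> space M. X \<omega> \<in> A \<and> Z \<omega> \<in> C} = \<dots>" .
  then have "emeasure M {\<omega> \<in> space M. X \<omega> \<in> A \<and> Z \<omega> \<in> C} = (\<integral>\<^sup>+\<omega>. ennreal (k \<omega> * indicator A (X \<omega>)) \<partial>M)"
    using nn_integral_eq_integral[OF integrable[of "\<lambda>\<omega>. indicator A (X \<omega>)"]] k01
    by (simp add: emeasure_eq_measure mult.commute)
  then show ?thesis
    unfolding k_def by (simp add: ennreal_mult'' ennreal_indicator mult.commute)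
qed

text \<open>
The kernel \<open>(x, y) \<mapsto> \<delta>\<^sub>x \<otimes> K y\<close>, written as an image of \<open>K y\<close>.
\<close>

definition resample_snd :: "'a \<times> 'b \<Rightarrow> ('a \<times> 'c) measure" where
  "resample_snd = (\<lambda>(x, y). distr (K y) (MX \<Otimes>\<^sub>M MZ) (\<lambda>z. (x, z)))"

lemma measurable_resample_snd: "resample_snd \<in> measurable (MX \<Otimes>\<^sub>M MY) (prob_algebra (MX \<Otimes>\<^sub>M MZ))"
  unfolding resample_snd_def by measurable

lemma emeasure_bind_resample_snd:
  assumes P: "P \<in> space (prob_algebra (MX \<Otimes>\<^sub>M MY))"
    and A [measurable]: "A \<in> sets MX" and C [measurable]: "C \<in> sets MZ"
  shows "emeasure (P \<bind> resample_snd) (A \<times> C) =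
    (\<integral>\<^sup>+xy. indicator A (fst xy) * ennreal (measure (K (snd xy)) C) \<partial>P)"
proof -
  have "emeasure (P \<bind> resample_snd) (A \<times> C) = (\<integral>\<^sup>+xy. emeasure (resample_snd xy) (A \<times> C) \<partial>P)"
    by (rule emeasure_bind_prob_algebra[OF P measurable_resample_snd]) auto
  also have "\<dots> = (\<integral>\<^sup>+xy. indicator A (fst xy) * ennreal (measure (K (snd xy)) C) \<partial>P)"
  proof (intro nn_integral_cong)
    fix xy assume "xy \<in> space P"
    moreover have "space P = space (MX \<Otimes>\<^sub>M MY)"
      using P by (auto simp: space_prob_algebra dest: sets_eq_imp_space_eq)
    ultimately obtain x y where xy: "xy = (x, y)" "x \<in> space MX" "y \<in> space MY"
      by (auto simp: space_pair_measure)
    have K_y [measurable_cong]: "sets (K y) = sets MZ"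
      using prob_K[OF xy(3)] by simp
    have sp: "space (K y) = space MZ"
      using K_y by (rule sets_eq_imp_space_eq)
    have "emeasure (resample_snd xy) (A \<times> C) = emeasure (K y) ((\<lambda>z. (x, z)) -` (A \<times> C) \<inter> space (K y))"
      unfolding xy(1) resample_snd_def prod.case using xy(2) by (intro emeasure_distr) auto
    also have "(\<lambda>z. (x, z)) -` (A \<times> C) \<inter> space (K y) = (if x \<in> A then C else {})"
      using sets.sets_into_space[OF C] sp by auto
    also have "emeasure (K y) \<dots> = indicator A (fst xy) * ennreal (measure (K (snd xy)) C)"
      using emeasure_K[OF xy(3)] xy(1) by simp
    finally show "emeasure (resample_snd xy) (A \<times> C) = indicator A (fst xy) * ennreal (measure (K (snd xy)) C)" .
  qed
  finally show ?thesis .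
qed

lemma law_X_Y: "distr M (MX \<Otimes>\<^sub>M MY) (\<lambda>\<omega>. (X \<omega>, Y \<omega>)) \<in> space (prob_algebra (MX \<Otimes>\<^sub>M MY))"
  by (simp add: space_prob_algebra prob_space_distr)

lemma product_law_X_Y: "distr M MX X \<Otimes>\<^sub>M distr M MY Y \<in> space (prob_algebra (MX \<Otimes>\<^sub>M MY))"
  by (auto simp: space_prob_algebra prob_space_distr intro!: prob_space_pair sets_pair_measure_cong)

text \<open>
Here conditional independence enters: drawing \<open>z\<close> with knowledge of \<open>y\<close> alone reproduces its
dependence on \<open>x\<close>.
\<close>

lemma joint_law_bind:
  assumes ci: "cond_indep M MX MY MZ X Y Z"
  shows "distr M (MX \<Otimes>\<^sub>M MY) (\<lambda>\<omega>. (X \<omega>, Y \<omega>)) \<bind> resample_snd = distr M (MX \<Otimes>\<^sub>M MZ) (\<lambda>\<omega>. (X \<omega>, Z \<omega>))"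
proof (rule measure_eqI_rectangles[of _ MX MZ])
  show "sets (distr M (MX \<Otimes>\<^sub>M MY) (\<lambda>\<omega>. (X \<omega>, Y \<omega>)) \<bind> resample_snd) = sets (MX \<Otimes>\<^sub>M MZ)"
    by (rule sets_bind'[OF law_X_Y measurable_resample_snd])
  show "finite_measure (distr M (MX \<Otimes>\<^sub>M MY) (\<lambda>\<omega>. (X \<omega>, Y \<omega>)) \<bind> resample_snd)"
    by (rule prob_space.finite_measure[OF prob_space_bind'[OF law_X_Y measurable_resample_snd]])
next
  fix A C assume A [measurable]: "A \<in> sets MX" and C [measurable]: "C \<in> sets MZ"
  show "emeasure (distr M (MX \<Otimes>\<^sub>M MY) (\<lambda>\<omega>. (X \<omega>, Y \<omega>)) \<bind> resample_snd) (A \<times> C) =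
      emeasure (distr M (MX \<Otimes>\<^sub>M MZ) (\<lambda>\<omega>. (X \<omega>, Z \<omega>))) (A \<times> C)"
    unfolding emeasure_bind_resample_snd[OF law_X_Y A C]
    by (subst nn_integral_distr, measurable, subst emeasure_distr)
      (auto simp: emeasure_X_Z[OF ci A C, symmetric] intro!: arg_cong[where f="emeasure M"])
qed simp

lemma product_law_bind:
  "(distr M MX X \<Otimes>\<^sub>M distr M MY Y) \<bind> resample_snd = distr M MX X \<Otimes>\<^sub>M distr M MZ Z"
proof (rule measure_eqI_rectangles[of _ MX MZ])
  show "sets ((distr M MX X \<Otimes>\<^sub>M distr M MY Y) \<bind> resample_snd) = sets (MX \<Otimes>\<^sub>M MZ)"
    by (rule sets_bind'[OF product_law_X_Y measurable_resample_snd])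
  show "finite_measure ((distr M MX X \<Otimes>\<^sub>M distr M MY Y) \<bind> resample_snd)"
    by (rule prob_space.finite_measure[OF prob_space_bind'[OF product_law_X_Y measurable_resample_snd]])
next
  fix A C assume A [measurable]: "A \<in> sets MX" and C [measurable]: "C \<in> sets MZ"
  interpret PY: prob_space "distr M MY Y" by (rule prob_space_distr) simp
  interpret PZ: prob_space "distr M MZ Z" by (rule prob_space_distr) simp
  have "emeasure ((distr M MX X \<Otimes>\<^sub>M distr M MY Y) \<bind> resample_snd) (A \<times> C) =
      (\<integral>\<^sup>+x. \<integral>\<^sup>+y. indicator A x * ennreal (measure (K y) C) \<partial>distr M MY Y \<partial>distr M MX X)"
    unfolding emeasure_bind_resample_snd[OF product_law_X_Y A C]
    by (subst PY.nn_integral_fst[symmetric]) auto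
  also have "\<dots> = (\<integral>\<^sup>+x. indicator A x * (\<integral>\<^sup>+y. ennreal (measure (K y) C) \<partial>distr M MY Y) \<partial>distr M MX X)"
    by (subst nn_integral_cmult) auto
  also have "\<dots> = emeasure (distr M MX X) A * (\<integral>\<^sup>+y. ennreal (measure (K y) C) \<partial>distr M MY Y)"
    by (subst nn_integral_multc) auto
  also have "(\<integral>\<^sup>+y. ennreal (measure (K y) C) \<partial>distr M MY Y) = emeasure (distr M MZ Z) C"
    by (subst nn_integral_distr, measurable, subst emeasure_distr)
      (auto simp: emeasure_Z[OF C, symmetric] intro!: arg_cong[where f="emeasure M"])
  also have "emeasure (distr M MX X) A * \<dots> = emeasure (distr M MX X \<Otimes>\<^sub>M distr M MZ Z) (A \<times> C)"
    by (rule PZ.emeasure_pair_measure_Times[symmetric]) auto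
  finally show "emeasure ((distr M MX X \<Otimes>\<^sub>M distr M MY Y) \<bind> resample_snd) (A \<times> C) =
      emeasure (distr M MX X \<Otimes>\<^sub>M distr M MZ Z) (A \<times> C)" .
qed (simp_all cong: sets_pair_measure_cong)

end

theorem proposition10:
  fixes M :: "'w measure" and MX :: "'a measure" and MY :: "'b measure" and MZ :: "'c measure"
    and X :: "'w \<Rightarrow> 'a" and Y :: "'w \<Rightarrow> 'b" and Z :: "'w \<Rightarrow> 'c"
    and f :: "real \<Rightarrow> ereal"
  assumes "prob_space M"
    and "X \<in> measurable M MX" and "Y \<in> measurable M MY" and "Z \<in> measurable M MZ"
    and "cond_indep M MX MY MZ X Y Z"
    and "\<exists>K. cond_distribution M MY MZ Y Z K"
    and "f \<in> csiszar_functions"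
  shows "csiszar_index f M MX MZ X Z \<le> csiszar_index f M MX MY X Y"
proof -
  obtain K where K: "cond_distribution M MY MZ Y Z K"
    using assms(6) by blast
  note setting = assms(1-4) K
  show ?thesis
    unfolding csiszar_index_def product_law_bind[OF setting, symmetric]
      joint_law_bind[OF setting assms(5), symmetric]
    by (rule f_divergence_bind_le[OF assms(7) product_law_X_Y[OF setting] law_X_Y[OF setting]
          measurable_resample_snd[OF setting]])
qed

end
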